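(* Let $(U,\Sigma,\mu)$ be a $\sigma$-finite measure space with a full ordered core $\mathcal A$, and let $X$ be a Banach function space over $U$ such that both $X$ and $X'$ contain all characteristic functions of sets of finite measure. The set $X\!\!\downarrow$, equipped with the norm $\|\cdot\|_{X\!\downarrow}$, is a Banach function space with the Fatou property. If $f\in X''$, then $\|f\|_{X\!\downarrow}\le\|f\|_{X''}$ and, if $f^o\in X''$ (where $f^o$ is a level function of $f$), then $\|f\|_{X\!\downarrow}\le\|f^o\|_{X''}$. The map $g\mapsto\widetilde g$ is sublinear. The set $\widetilde X$, equipped with the norm $\|\cdot\|_{\widetilde X}$, is a Banach function space. It has the Fatou property if $X$ does. Also, $X\!\!\downarrow=(\widetilde{X'})'$, with identical norms, and $(X\!\!\downarrow)'=\widetilde{X'}$, with identical norms. Finally, $\widetilde{L^\infty_\mu}=L^\infty_\mu$, with identical norms.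
   Context: Functions equal $\mu$-a.e. are identified. $L(\Sigma)$ is the set of $\Sigma$-measurable functions $U\to[-\infty,\infty]$. An ordered core of $(U,\Sigma,\mu)$ is a subset $\mathcal A\subseteq\Sigma$, totally ordered by inclusion, containing $\emptyset$, whose members all have finite $\mu$-measure. It is $\sigma$-bounded if $\bigcup\mathcal A=\bigcup\mathcal A_0$ for some countable $\mathcal A_0\subseteq\mathcal A$, and full if it is $\sigma$-bounded and $\bigcup\mathcal A=U$. $\sigma(\mathcal A)$ is the $\sigma$-ring generated by $\mathcal A$ (a $\sigma$-algebra on $U$ when $\mathcal A$ is full). Write $u\le_{\mathcal A}v$ if for all $A\in\mathcal A$, $v\in A$ implies $u\in A$. $L^\downarrow(\mathcal A)$ is the set of core decreasing functions: $\sigma(\mathcal A)$-measurable $f:U\to[0,\infty]$ with $f(u)\ge f(v)$ whenever $u\le_{\mathcal A}v$. A Banach function space over $U$ is a real Banach space $X\subseteq L(\Sigma)$ such that if $f\in L(\Sigma)$, $g\in X$ and $|f|\le g$ $\mu$-a.e., then $f\in X$ and $\|f\|_X=\||f|\|_X\le\|g\|_X$. It has the Fatou property if whenever $0\le f_n\in X$, $f_n\uparrow f$ $\mu$-a.e. and $\lim\|f_n\|_X<\infty$, then $f\in X$ and $\|f_n\|_X\uparrow\|f\|_X$. The associate space $X'$ is the set of $g\in L(\Sigma)$ with $\|g\|_{X'}=\sup_{\|f\|_X\le1}\int_U|fg|\,d\mu<\infty$; $X''=(X')'$. The down space $X\!\!\downarrow$ is the set of $f\in L(\Sigma)$ with $\|f\|_{X\!\downarrow}=\sup\{\int_U|f|g\,d\mu:g\in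 X'\cap L^\downarrow(\mathcal A),\ \|g\|_{X'}\le1\}<\infty$. A level function of $f\in L(\Sigma)$ is an $f^o\in L^\downarrow(\mathcal A)$ such that for all $g\in L^\downarrow(\mathcal A)$, $$\int_Uf^og\,d\mu=\sup\Big\{\int_U|f|h\,d\mu:h\in L^\downarrow(\mathcal A),\ \int_Ah\,d\mu\le\int_Ag\,d\mu\text{ for all }A\in\mathcal A\Big\}.$$ A least core decreasing majorant of $g\in L(\Sigma)$ is a $\widetilde g\in L^\downarrow(\mathcal A)$ with $|g|\le\widetilde g$ $\mu$-a.e. and such that $\widetilde g\le h$ $\mu$-a.e. for every $h\in L^\downarrow(\mathcal A)$ with $|g|\le h$ $\mu$-a.e. (it exists and is unique $\mu$-a.e.). $\widetilde X$ is the set of $g\in L(\Sigma)$ with $\widetilde g\in X$, with $\|g\|_{\widetilde X}=\|\widetilde g\|_X$. Sublinear means positive homogeneous and subadditive ($\mu$-a.e.). *)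

theory Defs
  imports "HOL-Probability.Essential_Supremum"
begin

section \<open>Ordered cores and core decreasing functions\<close>

definition ordered_core :: "'a measure \<Rightarrow> 'a set set \<Rightarrow> bool" where
  "ordered_core M \<A> \<longleftrightarrow>
     \<A> \<subseteq> sets M \<and> chain_subset \<A> \<and> {} \<in> \<A> \<and> (\<forall>A\<in>\<A>. emeasure M A < \<infinity>)"

definition sigma_bounded_core :: "'a set set \<Rightarrow> bool" where
  "sigma_bounded_core \<A> \<longleftrightarrow> (\<exists>\<A>0 \<subseteq> \<A>. countable \<A>0 \<and> \<Union>\<A> = \<Union>\<A>0)"

definition full_ordered_core :: "'a measure \<Rightarrow> 'a set set \<Rightarrow> bool" where
  "full_ordered_core M \<A> \<longleftrightarrow>
     ordered_core M \<A> \<and> sigma_bounded_core \<A> \<and> \<Union>\<A> = space M"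

text \<open>The \<open>\<sigma>\<close>-ring generated by a family of sets; in contrast to \<^const>\<open>sigma_sets\<close> there is no
  ambient set, and one closes under differences instead of complements.\<close>

inductive_set sigma_ring_sets :: "'a set set \<Rightarrow> 'a set set" for \<A> :: "'a set set" where
  Basic: "A \<in> \<A> \<Longrightarrow> A \<in> sigma_ring_sets \<A>"
| Empty: "{} \<in> sigma_ring_sets \<A>"
| Diff: "A \<in> sigma_ring_sets \<A> \<Longrightarrow> B \<in> sigma_ring_sets \<A> \<Longrightarrow> A - B \<in> sigma_ring_sets \<A>"
| Union: "(\<And>n::nat. A n \<in> sigma_ring_sets \<A>) \<Longrightarrow> (\<Union>n. A n) \<in> sigma_ring_sets \<A>"

definition core_le :: "'a set set \<Rightarrow> 'a \<Rightarrow> 'a \<Rightarrow> bool" where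
  "core_le \<A> u v \<longleftrightarrow> (\<forall>A\<in>\<A>. v \<in> A \<longrightarrow> u \<in> A)"

text \<open>Functions are total on the type \<^typ>\<open>'a\<close>; only their values on \<^term>\<open>space M\<close> matter.\<close>

definition core_decreasing :: "'a measure \<Rightarrow> 'a set set \<Rightarrow> ('a \<Rightarrow> ereal) set" where
  "core_decreasing M \<A> =
     {f. (\<forall>B\<in>sets borel. f -` B \<inter> space M \<in> sigma_ring_sets \<A>) \<and>
         (\<forall>u\<in>space M. 0 \<le> f u) \<and>
         (\<forall>u\<in>space M. \<forall>v\<in>space M. core_le \<A> u v \<longrightarrow> f v \<le> f u)}"


section \<open>Banach function spaces\<close>

text \<open>A set of extended real functions together with a norm. Values of \<open>fnorm\<close> outside
  \<open>elems\<close> carry no information. Functions equal almost everywhere are not literally identified;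
  instead the space and its norm are required to be invariant under a.e. equality, and all
  (in)equalities between elements are a.e.\<close>

record 'a fun_space =
  elems :: "('a \<Rightarrow> ereal) set"
  fnorm :: "('a \<Rightarrow> ereal) \<Rightarrow> real"

definition same_space :: "'a fun_space \<Rightarrow> 'a fun_space \<Rightarrow> bool" where
  "same_space X Y \<longleftrightarrow> elems X = elems Y \<and> (\<forall>f\<in>elems X. fnorm X f = fnorm Y f)"

text \<open>The elements of a vector space under the pointwise a.e. operations are finite a.e.: if
  \<open>f\<close> had an infinite value on a non-null set, \<open>f + (-f) = 0\<close> would have no meaning there.
  This makes explicit that the library's convention for \<open>\<infinity> - \<infinity>\<close> plays no role in the axioms.\<close>

definition ae_banach_space :: "'a measure \<Rightarrow> 'a fun_space \<Rightarrow> bool" where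
  "ae_banach_space M X \<longleftrightarrow>
     elems X \<subseteq> borel_measurable M \<and>
     (\<forall>f\<in>elems X. AE x in M. \<bar>f x\<bar> \<noteq> \<infinity>) \<and>
     (\<forall>f\<in>elems X. \<forall>g\<in>borel_measurable M. (AE x in M. f x = g x) \<longrightarrow>
        g \<in> elems X \<and> fnorm X g = fnorm X f) \<and>
     (\<lambda>x. 0) \<in> elems X \<and>
     (\<forall>f\<in>elems X. \<forall>g\<in>elems X. (\<lambda>x. f x + g x) \<in> elems X \<and>
        fnorm X (\<lambda>x. f x + g x) \<le> fnorm X f + fnorm X g) \<and>
     (\<forall>f\<in>elems X. \<forall>c::real. (\<lambda>x. ereal c * f x) \<in> elems X \<and>
        fnorm X (\<lambda>x. ereal c * f x) = \<bar>c\<bar> * fnorm X f) \<and>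
     (\<forall>f\<in>elems X. 0 \<le> fnorm X f \<and> (fnorm X f = 0 \<longleftrightarrow> (AE x in M. f x = 0))) \<and>
     (\<forall>F :: nat \<Rightarrow> 'a \<Rightarrow> ereal.
        (\<forall>n. F n \<in> elems X) \<and>
        (\<forall>e>0. \<exists>K. \<forall>m\<ge>K. \<forall>n\<ge>K. fnorm X (\<lambda>x. F m x - F n x) < e) \<longrightarrow>
        (\<exists>f\<in>elems X. (\<lambda>n. fnorm X (\<lambda>x. F n x - f x)) \<longlonglongrightarrow> 0))"

definition banach_function_space :: "'a measure \<Rightarrow> 'a fun_space \<Rightarrow> bool" where
  "banach_function_space M X \<longleftrightarrow>
     ae_banach_space M X \<and>
     (\<forall>f\<in>borel_measurable M. \<forall>g\<in>elems X. (AE x in M. \<bar>f x\<bar> \<le> g x) \<longrightarrow>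
        f \<in> elems X \<and> fnorm X f = fnorm X (\<lambda>x. \<bar>f x\<bar>) \<and> fnorm X (\<lambda>x. \<bar>f x\<bar>) \<le> fnorm X g)"

definition fatou_property :: "'a measure \<Rightarrow> 'a fun_space \<Rightarrow> bool" where
  "fatou_property M X \<longleftrightarrow>
     (\<forall>F :: nat \<Rightarrow> 'a \<Rightarrow> ereal. \<forall>f\<in>borel_measurable M.
        (\<forall>n. F n \<in> elems X \<and> (AE x in M. 0 \<le> F n x)) \<and>
        (AE x in M. incseq (\<lambda>n. F n x) \<and> (\<lambda>n. F n x) \<longlonglongrightarrow> f x) \<and>
        convergent (\<lambda>n. fnorm X (F n)) \<longrightarrow>
        f \<in> elems X \<and> incseq (\<lambda>n. fnorm X (F n)) \<and> (\<lambda>n. fnorm X (F n)) \<longlonglongrightarrow> fnorm X f)"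

text \<open>The space of all measurable functions on which a given \<open>[0,\<infinity>]\<close>-valued functional is
  finite, normed by that functional.\<close>

definition finite_part :: "'a measure \<Rightarrow> (('a \<Rightarrow> ereal) \<Rightarrow> ennreal) \<Rightarrow> 'a fun_space" where
  "finite_part M \<rho> =
     \<lparr>elems = {f \<in> borel_measurable M. \<rho> f < \<infinity>}, fnorm = (\<lambda>f. enn2real (\<rho> f))\<rparr>"

definition associate_norm :: "'a measure \<Rightarrow> 'a fun_space \<Rightarrow> ('a \<Rightarrow> ereal) \<Rightarrow> ennreal" where
  "associate_norm M X g =
     (SUP f\<in>{f \<in> elems X. fnorm X f \<le> 1}. \<integral>\<^sup>+x. e2ennreal \<bar>f x * g x\<bar> \<partial>M)"

definition associate :: "'a measure \<Rightarrow> 'a fun_space \<Rightarrow> 'a fun_space" where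
  "associate M X = finite_part M (associate_norm M X)"

definition Linfty :: "'a measure \<Rightarrow> 'a fun_space" where
  "Linfty M = finite_part M (\<lambda>f. esssup M (\<lambda>x. e2ennreal \<bar>f x\<bar>))"


section \<open>Down spaces, level functions and least core decreasing majorants\<close>

definition down_norm :: "'a measure \<Rightarrow> 'a set set \<Rightarrow> 'a fun_space \<Rightarrow> ('a \<Rightarrow> ereal) \<Rightarrow> ennreal" where
  "down_norm M \<A> X f =
     (SUP g\<in>{g \<in> elems (associate M X) \<inter> core_decreasing M \<A>. fnorm (associate M X) g \<le> 1}.
        \<integral>\<^sup>+x. e2ennreal (\<bar>f x\<bar> * g x) \<partial>M)"

definition down_space :: "'a measure \<Rightarrow> 'a set set \<Rightarrow> 'a fun_space \<Rightarrow> 'a fun_space" where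
  "down_space M \<A> X = finite_part M (down_norm M \<A> X)"

definition is_level_function ::
    "'a measure \<Rightarrow> 'a set set \<Rightarrow> ('a \<Rightarrow> ereal) \<Rightarrow> ('a \<Rightarrow> ereal) \<Rightarrow> bool" where
  "is_level_function M \<A> f fo \<longleftrightarrow>
     fo \<in> core_decreasing M \<A> \<and>
     (\<forall>g\<in>core_decreasing M \<A>.
        (\<integral>\<^sup>+x. e2ennreal (fo x * g x) \<partial>M) =
        (SUP h\<in>{h \<in> core_decreasing M \<A>.
                  \<forall>A\<in>\<A>. (\<integral>\<^sup>+x\<in>A. e2ennreal (h x) \<partial>M) \<le> (\<integral>\<^sup>+x\<in>A. e2ennreal (g x) \<partial>M)}.
           \<integral>\<^sup>+x. e2ennreal (\<bar>f x\<bar> * h x) \<partial>M))"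

definition is_least_core_majorant ::
    "'a measure \<Rightarrow> 'a set set \<Rightarrow> ('a \<Rightarrow> ereal) \<Rightarrow> ('a \<Rightarrow> ereal) \<Rightarrow> bool" where
  "is_least_core_majorant M \<A> g gt \<longleftrightarrow>
     gt \<in> core_decreasing M \<A> \<and> (AE x in M. \<bar>g x\<bar> \<le> gt x) \<and>
     (\<forall>h\<in>core_decreasing M \<A>. (AE x in M. \<bar>g x\<bar> \<le> h x) \<longrightarrow> (AE x in M. gt x \<le> h x))"

text \<open>A representative of the a.e. unique least core decreasing majorant; which one is chosen
  does not matter, as it is used only up to a.e. equality.\<close>

definition core_majorant ::
    "'a measure \<Rightarrow> 'a set set \<Rightarrow> ('a \<Rightarrow> ereal) \<Rightarrow> 'a \<Rightarrow> ereal" where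
  "core_majorant M \<A> g = (SOME gt. is_least_core_majorant M \<A> g gt)"

definition tilde_space :: "'a measure \<Rightarrow> 'a set set \<Rightarrow> 'a fun_space \<Rightarrow> 'a fun_space" where
  "tilde_space M \<A> X =
     \<lparr>elems = {g \<in> borel_measurable M. core_majorant M \<A> g \<in> elems X},
      fnorm = (\<lambda>g. fnorm X (core_majorant M \<A> g))\<rparr>"

text \<open>Sums are taken in \<^typ>\<open>ereal\<close>, so subadditivity below also covers the points where
  \<open>f x + g x\<close> is of the form \<open>\<infinity> - \<infinity>\<close>, which has the value \<open>\<infinity>\<close> by convention.\<close>

definition sublinear_ae ::
    "'a measure \<Rightarrow> (('a \<Rightarrow> ereal) \<Rightarrow> 'a \<Rightarrow> ereal) \<Rightarrow> bool" where
  "sublinear_ae M T \<longleftrightarrow>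
     (\<forall>f\<in>borel_measurable M. \<forall>c::real. 0 \<le> c \<longrightarrow>
        (AE x in M. T (\<lambda>x. ereal c * f x) x = ereal c * T f x)) \<and>
     (\<forall>f\<in>borel_measurable M. \<forall>g\<in>borel_measurable M.
        (AE x in M. T (\<lambda>x. f x + g x) x \<le> T f x + T g x))"

end

theory Submission
  imports Defs
begin

text \<open>
  The spaces built from \<open>X\<close> all have norms that depend on absolute values only, so each is described
  by a functional \<open>\<rho>\<close> on nonnegative measurable functions (\<open>normed_by\<close>); \<open>X\<close> itself enters through its
  unit ball and its norm on nonnegative functions (\<open>bfs_norm\<close>).  A few closure properties of
  \<open>\<rho>\<close> (locale \<open>function_norm\<close>; the decisive one is countable subadditivity, the
  Riesz--Fischer property) make the space a Banach function space, and compatibility with increasing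
  limits (locale \<open>fatou_norm\<close>) gives the Fatou property.

  Two constructions supply all the norms needed.  Suprema of integrals \<open>\<integral> f g\<close> over a set of test
  functions \<open>g\<close> (\<open>fatou_norm_pairing_norm\<close>) yield the associate space and, with core decreasing test
  functions, the down space.  Composition with the least core decreasing majorant
  (\<open>function_norm_majorant\<close>, \<open>fatou_norm_majorant\<close>) yields the tilde space; here one uses that the
  majorant is monotone, countably sublinear, and commutes with increasing limits, all of which is
  immediate from minimality and the closure of the core decreasing functions under sums and suprema.

  Write \<open>\<rho>'\<close> for the norm of \<open>X'\<close> and \<open>m f\<close> for the least core decreasing majorant.  Since
  \<open>\<integral> f h \<le> \<integral> f (m h)\<close> for \<open>f, h \<ge> 0\<close> and \<open>m h = h\<close> for core decreasing \<open>h\<close>, testing against core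
  decreasing functions \<open>g\<close> with \<open>\<rho>' g \<le> 1\<close> is the same as testing against all \<open>h\<close> with
  \<open>\<rho>' (m h) \<le> 1\<close> (\<open>down_eq_pairing_norm\<close>).  This is the identity of the down space with the
  associate of the tilde space of \<open>X'\<close>.  The associate of the down space is therefore the second
  associate of the tilde space of \<open>X'\<close>, whose norm has the Fatou property because \<open>\<rho>'\<close> has.  So the
  last duality is the Lorentz--Luxemburg theorem (\<open>lorentz_luxemburg\<close>): a saturated Fatou norm
  equals its second associate norm.

  Lorentz--Luxemburg is obtained without Hahn--Banach.  After truncation, the function to be
  separated from the unit ball is bounded with support of finite measure.  Among the functions of
  the ball below it there is one nearest in \<open>L\<^sup>2\<close>, and the difference to the nearest function is,
  up to scaling, the separating functional.
\<close>

section \<open>Function norms on nonnegative functions\<close>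

definition mag :: "('a \<Rightarrow> ereal) \<Rightarrow> 'a \<Rightarrow> ennreal" where
  "mag f = (\<lambda>x. e2ennreal \<bar>f x\<bar>)"

lemma mag_measurable [measurable]: "f \<in> borel_measurable M \<Longrightarrow> mag f \<in> borel_measurable M"
  unfolding mag_def by measurable

lemma mag_enn2ereal [simp]: "mag (\<lambda>x. enn2ereal (f x)) = f"
  by (simp add: mag_def)

lemma e2ennreal_abs_mult: "e2ennreal \<bar>a * b\<bar> = e2ennreal \<bar>a\<bar> * e2ennreal \<bar>b\<bar>"
proof -
  have "\<bar>a * b\<bar> = \<bar>a\<bar> * \<bar>b\<bar>"
    by (cases a; cases b) (auto simp: abs_mult)
  then have "enn2ereal (e2ennreal \<bar>a * b\<bar>) = enn2ereal (e2ennreal \<bar>a\<bar> * e2ennreal \<bar>b\<bar>)"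
    by (simp add: enn2ereal_e2ennreal times_ennreal.rep_eq)
  then show ?thesis by (simp add: enn2ereal_inject)
qed

lemma e2ennreal_abs_add_le: "e2ennreal \<bar>a + b\<bar> \<le> e2ennreal \<bar>a\<bar> + e2ennreal \<bar>b\<bar>"
proof -
  have "\<bar>a + b\<bar> \<le> \<bar>a\<bar> + \<bar>b\<bar>"
    by (cases a; cases b) auto
  then have "enn2ereal (e2ennreal \<bar>a + b\<bar>) \<le> enn2ereal (e2ennreal \<bar>a\<bar> + e2ennreal \<bar>b\<bar>)"
    by (simp add: enn2ereal_e2ennreal plus_ennreal.rep_eq)
  then show ?thesis by (simp add: less_eq_ennreal.rep_eq)
qed


lemma e2ennreal_le_iff: "0 \<le> b \<Longrightarrow> e2ennreal a \<le> e2ennreal b \<longleftrightarrow> a \<le> b"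
  by (metis e2ennreal_mono e2ennreal_neg enn2ereal_e2ennreal
      less_eq_ennreal.rep_eq linear order_trans)

lemma e2ennreal_abs_le_iff: "e2ennreal \<bar>a\<bar> \<le> e2ennreal \<bar>b\<bar> \<longleftrightarrow> \<bar>a\<bar> \<le> \<bar>b\<bar>"
  by (simp add: e2ennreal_le_iff)

lemma e2ennreal_abs_eq_0_iff: "e2ennreal \<bar>a\<bar> = 0 \<longleftrightarrow> a = 0"
  by (cases a) auto

lemma e2ennreal_abs_less_top_iff: "e2ennreal \<bar>a\<bar> < top \<longleftrightarrow> \<bar>a\<bar> \<noteq> \<infinity>"
  by (cases a) auto

lemma AE_mag_le_iff: "(AE x in M. mag f x \<le> mag g x) \<longleftrightarrow> (AE x in M. \<bar>f x\<bar> \<le> \<bar>g x\<bar>)"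
  by (simp add: mag_def e2ennreal_abs_le_iff)

lemma AE_mag_0_iff: "(AE x in M. mag f x = 0) \<longleftrightarrow> (AE x in M. f x = 0)"
  by (simp add: mag_def e2ennreal_abs_eq_0_iff)

lemma AE_mag_finite_iff: "(AE x in M. mag f x < top) \<longleftrightarrow> (AE x in M. \<bar>f x\<bar> \<noteq> \<infinity>)"
  by (simp add: mag_def e2ennreal_abs_less_top_iff)

lemma mag_indicator [simp]: "mag (indicator A) = indicator A"
proof -
  have "e2ennreal 1 = 1" by (simp add: one_ereal_def)
  then show ?thesis by (auto simp: mag_def indicator_def e2ennreal_neg)
qed

lemma mag_abs [simp]: "mag (\<lambda>x. \<bar>f x\<bar>) = mag f"
  by (simp add: mag_def)

lemma mag_scale: "mag (\<lambda>x. ereal c * f x) = (\<lambda>x. ennreal \<bar>c\<bar> * mag f x)"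
  by (simp add: mag_def e2ennreal_abs_mult)

text \<open>The functional takes the value \<open>top\<close> outside the space that it norms.  Countable
  subadditivity stands in for completeness, and it already contains the triangle inequality.\<close>

locale function_norm =
  fixes M :: "'a measure" and \<rho> :: "('a \<Rightarrow> ennreal) \<Rightarrow> ennreal"
  assumes mono: "f \<in> borel_measurable M \<Longrightarrow> g \<in> borel_measurable M \<Longrightarrow>
      (AE x in M. f x \<le> g x) \<Longrightarrow> \<rho> f \<le> \<rho> g"
    and scale: "f \<in> borel_measurable M \<Longrightarrow> c < top \<Longrightarrow> \<rho> (\<lambda>x. c * f x) = c * \<rho> f"
    and series: "(\<And>n. F n \<in> borel_measurable M) \<Longrightarrow> \<rho> (\<lambda>x. \<Sum>n. F n x) \<le> (\<Sum>n. \<rho> (F n))"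
    and zero_imp: "f \<in> borel_measurable M \<Longrightarrow> \<rho> f = 0 \<Longrightarrow> AE x in M. f x = 0"
    and finite_imp: "f \<in> borel_measurable M \<Longrightarrow> \<rho> f < top \<Longrightarrow> AE x in M. f x < top"
begin

lemma cong: "f \<in> borel_measurable M \<Longrightarrow> g \<in> borel_measurable M \<Longrightarrow>
    (AE x in M. f x = g x) \<Longrightarrow> \<rho> f = \<rho> g"
  by (intro antisym mono) auto

lemma zero [simp]: "\<rho> (\<lambda>x. 0) = 0"
  using scale[of "\<lambda>x. 0" 0] by simp

lemma add:
  assumes [measurable]: "f \<in> borel_measurable M" "g \<in> borel_measurable M"
  shows "\<rho> (\<lambda>x. f x + g x) \<le> \<rho> f + \<rho> g"
proof -
  define F where "F n = (if n = 0 then f else if n = 1 then g else (\<lambda>x. 0))" for n :: nat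
  have [measurable]: "F n \<in> borel_measurable M" for n by (simp add: F_def)
  have "(\<Sum>n. F n x) = f x + g x" for x
    by (subst suminf_finite[of "{0,1}"]) (auto simp: F_def)
  moreover have "(\<Sum>n. \<rho> (F n)) = \<rho> f + \<rho> g"
    by (subst suminf_finite[of "{0,1}"]) (auto simp: F_def)
  ultimately show ?thesis using series[of F] by simp
qed

lemma sum_le:
  assumes [measurable]: "\<And>i. F i \<in> borel_measurable M" and "finite I"
  shows "\<rho> (\<lambda>x. \<Sum>i\<in>I. F i x) \<le> (\<Sum>i\<in>I. \<rho> (F i))"
  using \<open>finite I\<close>
proof induction
  case (insert i I)
  then show ?case
    using order_trans[OF add[of "F i" "\<lambda>x. \<Sum>i\<in>I. F i x"] add_left_mono[OF insert.IH]] by simp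
qed simp

lemma zero_iff: "f \<in> borel_measurable M \<Longrightarrow> \<rho> f = 0 \<longleftrightarrow> (AE x in M. f x = 0)"
  using zero_imp cong[of f "\<lambda>x. 0"] by auto

end

text \<open>The link between a space of signed functions and a functional on nonnegative ones.  Spaces are
  compared up to the values of \<open>fnorm\<close> outside \<open>elems\<close>, as in \<open>same_space\<close>.\<close>

definition normed_by ::
    "'a measure \<Rightarrow> 'a fun_space \<Rightarrow> (('a \<Rightarrow> ennreal) \<Rightarrow> ennreal) \<Rightarrow> bool" where
  "normed_by M Y \<rho> \<longleftrightarrow> elems Y = {f \<in> borel_measurable M. \<rho> (mag f) < top} \<and>
     (\<forall>f\<in>elems Y. fnorm Y f = enn2real (\<rho> (mag f)))"

lemma normed_by_mem: "normed_by M Y \<rho> \<Longrightarrow> f \<in> elems Y \<longleftrightarrow> f \<in> borel_measurable M \<and> \<rho> (mag f) < top"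
  by (simp add: normed_by_def)

lemma normed_by_norm: "normed_by M Y \<rho> \<Longrightarrow> f \<in> elems Y \<Longrightarrow> ennreal (fnorm Y f) = \<rho> (mag f)"
  by (auto simp: normed_by_def)

lemma normed_by_norm_nonneg: "normed_by M Y \<rho> \<Longrightarrow> f \<in> elems Y \<Longrightarrow> 0 \<le> fnorm Y f"
  by (auto simp: normed_by_def)

lemma normed_by_norm_le:
  assumes "normed_by M Y \<rho>" "f \<in> elems Y" "0 \<le> c"
  shows "fnorm Y f \<le> c \<longleftrightarrow> \<rho> (mag f) \<le> ennreal c"
  using assms(3) by (simp flip: normed_by_norm[OF assms(1,2)])

lemma normed_by_finite_part: "normed_by M (finite_part M (\<lambda>f. \<rho> (mag f))) \<rho>"
  by (simp add: normed_by_def finite_part_def)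

lemma normed_by_same_space:
  assumes "normed_by M Y \<rho>" "normed_by M Z \<rho>'"
    and "\<And>f. f \<in> borel_measurable M \<Longrightarrow> \<rho> f = \<rho>' f"
  shows "same_space Y Z"
  using assms by (auto simp: normed_by_def same_space_def)

lemma (in function_norm) small_multiple:
  assumes [measurable]: "f \<in> borel_measurable M" and "\<rho> f < top"
  obtains c where "0 < c" "c < top" "\<rho> (\<lambda>x. c * f x) \<le> 1"
proof -
  obtain b where b: "\<rho> f = ennreal b" "0 \<le> b" using assms(2) by (cases "\<rho> f") auto
  have "\<rho> (\<lambda>x. ennreal (1 / (b + 1)) * f x) = ennreal (1 / (b + 1) * b)"
    using b by (subst scale) (auto simp flip: ennreal_mult)
  also have "\<dots> \<le> 1" using b(2) by (simp add: field_simps)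
  finally show ?thesis using b(2) that[of "ennreal (1 / (b + 1))"] by simp
qed

text \<open>A subsequence with rapidly decreasing steps has an a.e. absolutely convergent telescoping
  series, because countable subadditivity makes the norm of the sum of the absolute steps finite.
  The tails of that sum dominate the distance to the pointwise limit and have small norm.\<close>

lemma (in function_norm) complete:
  assumes Y: "normed_by M Y \<rho>" and F: "\<And>n. F n \<in> elems Y"
    and diff: "\<And>f g. f \<in> elems Y \<Longrightarrow> g \<in> elems Y \<Longrightarrow> (\<lambda>x. f x - g x) \<in> elems Y"
    and Cauchy: "\<forall>e>0. \<exists>K. \<forall>m\<ge>K. \<forall>n\<ge>K. fnorm Y (\<lambda>x. F m x - F n x) < e"
  shows "\<exists>f\<in>elems Y. (\<lambda>n. fnorm Y (\<lambda>x. F n x - f x)) \<longlonglongrightarrow> 0"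
proof -
  have [measurable]: "F n \<in> borel_measurable M" for n
    using F Y by (auto simp: normed_by_mem)
  have finF: "AE x in M. \<forall>n. \<bar>F n x\<bar> \<noteq> \<infinity>"
    unfolding AE_all_countable AE_mag_finite_iff[symmetric]
    using F Y by (auto simp: normed_by_mem intro!: finite_imp)
  have "\<forall>k. \<exists>K. \<forall>m\<ge>K. \<forall>n\<ge>K. fnorm Y (\<lambda>x. F m x - F n x) < (1/2)^k"
    using Cauchy by simp
  from choice[OF this]
  obtain K where K: "m \<ge> K k \<Longrightarrow> n \<ge> K k \<Longrightarrow> fnorm Y (\<lambda>x. F m x - F n x) < (1/2)^k" for k m n
    by blast
  define r where "r k = (\<Sum>i\<le>k. K i)" for k
  have rK: "r k \<ge> K k" for k
    unfolding r_def by (simp add: member_le_sum)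
  have rmono: "r k \<le> r j" if "k \<le> j" for k j
    unfolding r_def using that by (intro sum_mono2) auto
  define d where "d k = mag (\<lambda>x. F (r (Suc k)) x - F (r k) x)" for k
  have [measurable]: "d k \<in> borel_measurable M" for k
    unfolding d_def by measurable
  \<comment> \<open>\<open>r\<close> is monotone and dominates \<open>K\<close>, so step \<open>k\<close> is controlled by the Cauchy bound at \<open>K k\<close>.\<close>
  have rho_d: "\<rho> (d k) \<le> ennreal ((1/2)^k)" for k
    unfolding d_def using K[of k "r (Suc k)" "r k"] rK[of k] rmono[of k "Suc k"]
    by (subst normed_by_norm_le[OF Y, symmetric]) (auto intro!: diff F)
  have tail: "\<rho> (\<lambda>x. \<Sum>j. d (j + k) x) \<le> ennreal (2 * (1/2)^k)" for k
  proof -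
    have "\<rho> (\<lambda>x. \<Sum>j. d (j + k) x) \<le> (\<Sum>j. \<rho> (d (j + k)))"
      by (rule series) measurable
    also have "\<dots> \<le> (\<Sum>j. ennreal ((1/2)^(j + k)))"
      by (intro suminf_le rho_d) auto
    also have "\<dots> = ennreal (2 * (1/2)^k)"
    proof (rule suminf_ennreal_eq)
      have "(\<lambda>j. (1/2)^k * (1/2)^j) sums ((1/2)^k * (1 / (1 - 1/2)) :: real)"
        by (intro sums_mult geometric_sums) auto
      then show "(\<lambda>j. (1/2)^(j + k)) sums (2 * (1/2)^k :: real)"
        by (simp add: power_add mult.commute)
    qed simp
    finally show ?thesis .
  qed
  define f where "f x = ereal (lim (\<lambda>k. real_of_ereal (F (r k) x)))" for x
  have f_meas [measurable]: "f \<in> borel_measurable M"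
    unfolding f_def by measurable
  have "AE x in M. (\<Sum>j. d (j + 0) x) < top"
    by (rule finite_imp) (use tail[of 0] in \<open>auto simp: top.not_eq_extremum intro: le_less_trans\<close>)
  with finF have AE_bound: "AE x in M. \<forall>k. mag (\<lambda>x. F (r k) x - f x) x \<le> (\<Sum>j. d (j + k) x)"
  proof eventually_elim
    case (elim x)
    define a where "a k = real_of_ereal (F (r k) x)" for k
    have Fa: "F (r k) x = ereal (a k)" for k
      using elim(1) by (simp add: a_def ereal_real)
    have d_a: "d k x = ennreal \<bar>a (Suc k) - a k\<bar>" for k
      by (simp add: d_def mag_def Fa)
    have summ: "summable (\<lambda>k. \<bar>a (Suc k) - a k\<bar>)"
      using elim(2) by (intro summable_suminf_not_top) (auto simp: d_a less_top)
    have "summable (\<lambda>k. a (Suc k) - a k)"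
      by (rule summable_rabs_cancel[OF summ])
    then have "convergent (\<lambda>n. a n - a 0)"
      unfolding summable_iff_convergent by (simp only: sum_lessThan_telescope)
    then have "convergent a"
      by (rule convergent_diff_const_right_iff[THEN iffD1])
    then have lim: "a \<longlonglongrightarrow> lim a" by (rule convergent_LIMSEQ_iff[THEN iffD1])
    have "\<bar>a k - lim a\<bar> \<le> (\<Sum>j. \<bar>a (Suc (j + k)) - a (j + k)\<bar>)" for k
    proof -
      have "(\<lambda>j. a (Suc j + k) - a (j + k)) sums (lim a - a (0 + k))"
        using telescope_sums[OF LIMSEQ_ignore_initial_segment[OF lim, of k]] by simp
      moreover have "summable (\<lambda>j. \<bar>a (Suc j + k) - a (j + k)\<bar>)"
        using summable_ignore_initial_segment[OF summ, of k] by simp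
      ultimately show ?thesis
        using summable_rabs[of "\<lambda>j. a (Suc j + k) - a (j + k)"] by (auto simp: sums_iff)
    qed
    then have "ennreal \<bar>a k - lim a\<bar> \<le> (\<Sum>j. d (j + k) x)" for k
      unfolding d_a using summable_ignore_initial_segment[OF summ, of k]
      by (subst suminf_ennreal2) (auto intro!: ennreal_leI)
    then show ?case
      by (simp add: mag_def Fa f_def a_def[symmetric])
  qed
  have rho_f: "\<rho> (mag (\<lambda>x. F (r k) x - f x)) \<le> ennreal (2 * (1/2)^k)" for k
    by (rule order_trans[OF mono tail]) (use AE_bound in auto)
  have diff_mem: "(\<lambda>x. F (r k) x - f x) \<in> elems Y" for k
    using rho_f[of k] by (auto simp: normed_by_mem[OF Y] top.not_eq_extremum intro: le_less_trans)
  have "\<rho> (mag f) \<le> \<rho> (\<lambda>x. mag (F (r 0)) x + mag (\<lambda>x. F (r 0) x - f x) x)"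
  proof (rule mono)
    show "AE x in M. mag f x \<le> mag (F (r 0)) x + mag (\<lambda>x. F (r 0) x - f x) x"
      using finF
    proof eventually_elim
      case (elim x)
      then obtain a where "F (r 0) x = ereal a" by (metis ereal_real)
      then show ?case
        by (simp add: mag_def f_def flip: ennreal_plus)
    qed
  qed auto
  also have "\<dots> \<le> \<rho> (mag (F (r 0))) + \<rho> (mag (\<lambda>x. F (r 0) x - f x))"
    by (rule add) auto
  also have "\<dots> < top"
    using diff_mem[of 0] F[of "r 0"] by (simp add: normed_by_mem[OF Y])
  finally have f_mem: "f \<in> elems Y" by (simp add: normed_by_mem[OF Y])
  have bound: "fnorm Y (\<lambda>x. F n x - f x) \<le> 3 * (1/2)^k" if "n \<ge> r k" for n k
  proof -
    have *: "\<rho> (mag (\<lambda>x. F n x - f x)) \<le>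
        \<rho> (\<lambda>x. mag (\<lambda>x. F n x - F (r k) x) x + mag (\<lambda>x. F (r k) x - f x) x)"
    proof (rule mono)
      show "AE x in M. mag (\<lambda>x. F n x - f x) x \<le>
          mag (\<lambda>x. F n x - F (r k) x) x + mag (\<lambda>x. F (r k) x - f x) x"
        using finF
      proof eventually_elim
        case (elim x)
        then obtain a b where "F (r k) x = ereal a" "F n x = ereal b" by (metis ereal_real)
        then show ?case
          by (simp add: mag_def f_def flip: ennreal_plus)
      qed
    qed auto
    also have "\<dots> \<le> \<rho> (mag (\<lambda>x. F n x - F (r k) x)) + \<rho> (mag (\<lambda>x. F (r k) x - f x))"
      by (rule add) auto
    also have "\<dots> \<le> ennreal ((1/2)^k) + ennreal (2 * (1/2)^k)"
    proof (intro add_mono rho_f)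
      show "\<rho> (mag (\<lambda>x. F n x - F (r k) x)) \<le> ennreal ((1/2)^k)"
        using K[of k n "r k"] rK[of k] that
        by (subst normed_by_norm_le[OF Y, symmetric]) (auto intro!: diff F)
    qed
    also have "\<dots> = ennreal (3 * (1/2)^k)"
      by (simp flip: ennreal_plus)
    finally show ?thesis
      by (subst normed_by_norm_le[OF Y]) (auto intro!: diff F f_mem)
  qed
  have "(\<lambda>n. fnorm Y (\<lambda>x. F n x - f x)) \<longlonglongrightarrow> 0"
  proof (rule LIMSEQ_I)
    fix e :: real assume "0 < e"
    then obtain k where k: "(1/2)^k < e / 3"
      using real_arch_pow_inv[of "e/3" "1/2"] by auto
    show "\<exists>no. \<forall>n\<ge>no. norm (fnorm Y (\<lambda>x. F n x - f x) - 0) < e"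
    proof (intro exI allI impI)
      fix n assume "r k \<le> n"
      then have "fnorm Y (\<lambda>x. F n x - f x) < e" using bound[of k n] k by simp
      then show "norm (fnorm Y (\<lambda>x. F n x - f x) - 0) < e"
        using normed_by_norm_nonneg[OF Y diff[OF F f_mem], of n] by simp
    qed
  qed
  with f_mem show ?thesis by blast
qed

lemma (in function_norm) banach_function_space:
  assumes Y: "normed_by M Y \<rho>"
  shows "banach_function_space M Y"
proof -
  note mem = normed_by_mem[OF Y]
  have norm: "fnorm Y f = enn2real (\<rho> (mag f))" if "f \<in> elems Y" for f
    using that Y by (simp add: normed_by_def)
  have add_rho: "\<rho> (mag (\<lambda>x. f x + g x)) \<le> \<rho> (mag f) + \<rho> (mag g)"
    if "f \<in> elems Y" "g \<in> elems Y" for f g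
  proof -
    have [measurable]: "f \<in> borel_measurable M" "g \<in> borel_measurable M"
      using that mem by auto
    have "\<rho> (mag (\<lambda>x. f x + g x)) \<le> \<rho> (\<lambda>x. mag f x + mag g x)"
      by (rule mono) (auto simp: mag_def e2ennreal_abs_add_le)
    also have "\<dots> \<le> \<rho> (mag f) + \<rho> (mag g)" by (rule add) auto
    finally show ?thesis .
  qed
  have add_mem: "(\<lambda>x. f x + g x) \<in> elems Y" if "f \<in> elems Y" "g \<in> elems Y" for f g
    using add_rho[OF that] that by (auto simp: mem intro: le_less_trans)
  have add_norm: "fnorm Y (\<lambda>x. f x + g x) \<le> fnorm Y f + fnorm Y g"
    if "f \<in> elems Y" "g \<in> elems Y" for f g
    using add_rho[OF that] that
    by (subst normed_by_norm_le[OF Y add_mem])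
       (auto simp: normed_by_norm[OF Y] normed_by_norm_nonneg[OF Y] ennreal_plus)
  have scale_rho: "\<rho> (mag (\<lambda>x. ereal c * f x)) = ennreal \<bar>c\<bar> * \<rho> (mag f)" if "f \<in> elems Y" for f c
    unfolding mag_scale using that by (intro scale) (auto simp: mem)
  have scale_mem: "(\<lambda>x. ereal c * f x) \<in> elems Y" if "f \<in> elems Y" for f c
    using that scale_rho[OF that, of c] by (auto simp: mem ennreal_mult_less_top)
  have solid: "f \<in> elems Y \<and> fnorm Y f \<le> fnorm Y g"
    if "f \<in> borel_measurable M" "g \<in> elems Y" "AE x in M. \<bar>f x\<bar> \<le> \<bar>g x\<bar>" for f g
  proof -
    have [measurable]: "f \<in> borel_measurable M" "g \<in> borel_measurable M"
      using that mem by auto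
    have le: "\<rho> (mag f) \<le> \<rho> (mag g)"
      using that by (intro mono) (auto simp: AE_mag_le_iff)
    then have "f \<in> elems Y" using that by (auto simp: mem intro: le_less_trans)
    with le that show ?thesis
      by (auto simp: normed_by_norm_le[OF Y] normed_by_norm[OF Y] normed_by_norm_nonneg[OF Y])
  qed
  have diff: "(\<lambda>x. f x - g x) \<in> elems Y" if "f \<in> elems Y" "g \<in> elems Y" for f g
  proof -
    have "f x + ereal (-1) * g x = f x - g x" for x
      by (cases "g x") (simp_all add: minus_ereal_def)
    then show ?thesis
      using add_mem[OF that(1) scale_mem[OF that(2), of "-1"]] by (simp only:)
  qed
  have eqv: "g \<in> elems Y \<and> fnorm Y g = fnorm Y f"
    if "f \<in> elems Y" "g \<in> borel_measurable M" "AE x in M. f x = g x" for f g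
  proof -
    have "AE x in M. \<bar>g x\<bar> \<le> \<bar>f x\<bar>" using that(3) by eventually_elim simp
    moreover have "AE x in M. \<bar>f x\<bar> \<le> \<bar>g x\<bar>" using that(3) by eventually_elim simp
    ultimately show ?thesis
      using solid[of g f] solid[of f g] that mem by fastforce
  qed
  have "ae_banach_space M Y"
    unfolding ae_banach_space_def
  proof (intro conjI ballI allI impI)
    show "elems Y \<subseteq> borel_measurable M" using mem by auto
    show "AE x in M. \<bar>f x\<bar> \<noteq> \<infinity>" if "f \<in> elems Y" for f
      using that unfolding AE_mag_finite_iff[symmetric] by (auto simp: mem intro!: finite_imp)
    show "(\<lambda>x. 0) \<in> elems Y" by (simp add: mem mag_def e2ennreal_neg)
    show "fnorm Y (\<lambda>x. ereal c * f x) = \<bar>c\<bar> * fnorm Y f" if "f \<in> elems Y" for f c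
      using that scale_rho[OF that, of c] scale_mem[OF that, of c] by (simp add: norm enn2real_mult)
    show "0 \<le> fnorm Y f" if "f \<in> elems Y" for f using that by (simp add: norm)
    show "fnorm Y f = 0 \<longleftrightarrow> (AE x in M. f x = 0)" if "f \<in> elems Y" for f
      using that by (auto simp: norm enn2real_eq_0_iff AE_mag_0_iff[symmetric] zero_iff mem)
    show "\<exists>f\<in>elems Y. (\<lambda>n. fnorm Y (\<lambda>x. F n x - f x)) \<longlonglongrightarrow> 0"
      if "(\<forall>n. F n \<in> elems Y) \<and> (\<forall>e>0. \<exists>K. \<forall>m\<ge>K. \<forall>n\<ge>K. fnorm Y (\<lambda>x. F m x - F n x) < e)" for F
      using complete[OF Y _ diff, of F] that by blast
  qed (use add_mem add_norm scale_mem eqv in auto)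
  moreover have "f \<in> elems Y \<and> fnorm Y f = fnorm Y (\<lambda>x. \<bar>f x\<bar>) \<and> fnorm Y (\<lambda>x. \<bar>f x\<bar>) \<le> fnorm Y g"
    if "f \<in> borel_measurable M" "g \<in> elems Y" "AE x in M. \<bar>f x\<bar> \<le> g x" for f g
  proof -
    have "AE x in M. \<bar>f x\<bar> \<le> \<bar>g x\<bar>" using that(3)
      by eventually_elim (metis abs_ereal_ge0 abs_ereal_pos order_trans)
    then have "f \<in> elems Y" "fnorm Y f \<le> fnorm Y g" using solid that by auto
    moreover from this have "(\<lambda>x. \<bar>f x\<bar>) \<in> elems Y"
      using that(1) by (simp add: mem borel_measurable_ereal_abs)
    ultimately show ?thesis by (simp add: norm)
  qed
  ultimately show ?thesis
    unfolding banach_function_space_def by blast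
qed

lemma normed_by_compare:
  assumes Y: "normed_by M Y \<rho>" and Z: "normed_by M Z \<rho>'"
    and g: "g \<in> elems Z" and f: "f \<in> borel_measurable M" and le: "\<rho> (mag f) \<le> \<rho>' (mag g)"
  shows "f \<in> elems Y \<and> fnorm Y f \<le> fnorm Z g"
proof -
  have mem: "f \<in> elems Y"
    using le g f by (auto simp: normed_by_mem[OF Y] normed_by_mem[OF Z] intro: le_less_trans)
  moreover have "fnorm Y f \<le> fnorm Z g"
    using le by (subst normed_by_norm_le[OF Y mem normed_by_norm_nonneg[OF Z g]])
      (simp add: normed_by_norm[OF Z g])
  ultimately show ?thesis ..
qed


section \<open>The Fatou property and norms given by pairings\<close>

locale fatou_norm = function_norm +
  assumes monotone: "(\<And>n. F n \<in> borel_measurable M) \<Longrightarrow> (AE x in M. incseq (\<lambda>n. F n x)) \<Longrightarrow>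
      \<rho> (\<lambda>x. SUP n. F n x) = (SUP n. \<rho> (F n))"
begin

lemma fatou_property:
  assumes Y: "normed_by M Y \<rho>"
  shows "fatou_property M Y"
  unfolding fatou_property_def
proof (intro allI ballI impI)
  fix F :: "nat \<Rightarrow> 'a \<Rightarrow> ereal" and f
  assume f [measurable]: "f \<in> borel_measurable M"
    and *: "(\<forall>n. F n \<in> elems Y \<and> (AE x in M. 0 \<le> F n x)) \<and>
        (AE x in M. incseq (\<lambda>n. F n x) \<and> (\<lambda>n. F n x) \<longlonglongrightarrow> f x) \<and>
        convergent (\<lambda>n. fnorm Y (F n))"
  then have F: "F n \<in> elems Y" for n by simp
  then have [measurable]: "F n \<in> borel_measurable M" for n
    by (simp add: normed_by_mem[OF Y])
  have "AE x in M. \<forall>n. 0 \<le> F n x" using * by (simp add: AE_all_countable)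
  moreover have "AE x in M. incseq (\<lambda>n. F n x) \<and> (\<lambda>n. F n x) \<longlonglongrightarrow> f x" using * by simp
  ultimately have AE: "AE x in M. incseq (\<lambda>n. mag (F n) x) \<and> mag f x = (SUP n. mag (F n) x)"
  proof eventually_elim
    case (elim x)
    then have inc: "incseq (\<lambda>n. mag (F n) x)"
      by (auto simp: mag_def mono_def intro!: e2ennreal_mono)
    have "0 \<le> f x"
      using elim by (intro LIMSEQ_le_const[of "\<lambda>n. F n x"]) auto
    then have "(\<lambda>n. mag (F n) x) \<longlonglongrightarrow> mag f x"
      using elim by (auto simp: mag_def intro!: tendsto_e2ennrealI)
    with LIMSEQ_SUP[OF inc] inc show ?case
      using LIMSEQ_unique by blast
  qed
  have SUP: "\<rho> (mag f) = (SUP n. \<rho> (mag (F n)))"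
  proof -
    have "\<rho> (mag f) = \<rho> (\<lambda>x. SUP n. mag (F n) x)"
      by (rule cong) (use AE in auto)
    also have "\<dots> = (SUP n. \<rho> (mag (F n)))"
      by (rule monotone) (use AE in auto)
    finally show ?thesis .
  qed
  have inc_rho: "incseq (\<lambda>n. \<rho> (mag (F n)))"
    unfolding mono_def by (auto intro!: mono eventually_mono[OF AE] simp: mono_def)
  obtain C where C: "fnorm Y (F n) \<le> C" for n
  proof -
    have "Bseq (\<lambda>n. fnorm Y (F n))" using * by (intro convergent_imp_Bseq) simp
    then show ?thesis using that by (auto simp: Bseq_def dest: abs_le_D1)
  qed
  have "\<rho> (mag f) \<le> ennreal C"
    unfolding SUP by (rule SUP_least) (use C in \<open>simp flip: normed_by_norm[OF Y F] add: ennreal_leI\<close>)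
  then have f_mem: "f \<in> elems Y"
    by (auto simp: normed_by_mem[OF Y] intro: le_less_trans)
  have inc: "incseq (\<lambda>n. fnorm Y (F n))"
    using inc_rho by (simp add: mono_def normed_by_norm_nonneg[OF Y F] flip: normed_by_norm[OF Y F])
  have "(\<lambda>n. \<rho> (mag (F n))) \<longlonglongrightarrow> \<rho> (mag f)"
    unfolding SUP by (rule LIMSEQ_SUP[OF inc_rho])
  then have "(\<lambda>n. fnorm Y (F n)) \<longlonglongrightarrow> fnorm Y f"
    by (simp add: normed_by_norm_nonneg[OF Y] F f_mem flip: normed_by_norm[OF Y F] normed_by_norm[OF Y f_mem])
  then show "f \<in> elems Y \<and> incseq (\<lambda>n. fnorm Y (F n)) \<and> (\<lambda>n. fnorm Y (F n)) \<longlonglongrightarrow> fnorm Y f"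
    using f_mem inc by blast
qed

end

definition pairing_norm :: "'a measure \<Rightarrow> ('a \<Rightarrow> ennreal) set \<Rightarrow> ('a \<Rightarrow> ennreal) \<Rightarrow> ennreal" where
  "pairing_norm M B f = (SUP g\<in>B. \<integral>\<^sup>+x. f x * g x \<partial>M)"

lemma pairing_norm_leI:
  "(\<And>g. g \<in> B \<Longrightarrow> (\<integral>\<^sup>+x. f x * g x \<partial>M) \<le> c) \<Longrightarrow> pairing_norm M B f \<le> c"
  unfolding pairing_norm_def by (rule SUP_least)

lemma pairing_norm_upper: "g \<in> B \<Longrightarrow> (\<integral>\<^sup>+x. f x * g x \<partial>M) \<le> pairing_norm M B f"
  unfolding pairing_norm_def by (rule SUP_upper)

lemma AE_coverI:
  fixes A :: "nat \<Rightarrow> 'a set"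
  assumes cover: "(\<Union>n. A n) = space M" and AE: "\<And>n. AE x in M. x \<in> A n \<longrightarrow> P x"
  shows "AE x in M. P x"
proof -
  have "AE x in M. \<forall>n. x \<in> A n \<longrightarrow> P x"
    using AE by (subst AE_all_countable) blast
  with AE_space show ?thesis
    by eventually_elim (use cover in auto)
qed

text \<open>Integration against a fixed function is countably additive and continuous along increasing
  sequences, and both properties survive the supremum over \<open>B\<close> as inequality and equality,
  respectively.  Multiples of indicators in \<open>B\<close> that cover the space make the functional definite
  and force functions of finite norm to be finite a.e.\<close>

lemma fatou_norm_pairing_norm:
  fixes A :: "nat \<Rightarrow> 'a set"
  assumes B: "B \<subseteq> borel_measurable M"
    and A: "\<And>n. A n \<in> sets M" "(\<Union>n. A n) = space M"
    and sat: "\<And>n. \<exists>c>0. (\<lambda>x. c * indicator (A n) x) \<in> B"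
  shows "fatou_norm M (pairing_norm M B)"
proof
  note [measurable] = A(1)
  have Bm: "g \<in> borel_measurable M" if "g \<in> B" for g using B that by auto

  show "pairing_norm M B f \<le> pairing_norm M B g"
    if "AE x in M. f x \<le> g x" for f g
    unfolding pairing_norm_def
    by (intro SUP_mono') (auto intro!: nn_integral_mono_AE eventually_mono[OF that] mult_right_mono)
  show "pairing_norm M B (\<lambda>x. c * f x) = c * pairing_norm M B f"
    if [measurable]: "f \<in> borel_measurable M" for f c
  proof -
    have "(\<integral>\<^sup>+x. c * f x * g x \<partial>M) = c * (\<integral>\<^sup>+x. f x * g x \<partial>M)" if "g \<in> B" for g
      using Bm[OF that] by (simp add: mult.assoc nn_integral_cmult)
    then show ?thesis
      unfolding pairing_norm_def by (simp add: SUP_mult_left_ennreal)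
  qed
  show "pairing_norm M B (\<lambda>x. \<Sum>n. F n x) \<le> (\<Sum>n. pairing_norm M B (F n))"
    if [measurable]: "\<And>n. F n \<in> borel_measurable M" for F :: "nat \<Rightarrow> 'a \<Rightarrow> ennreal"
  proof (rule pairing_norm_leI)
    fix g assume g: "g \<in> B"
    note [measurable] = Bm[OF this]
    have "(\<integral>\<^sup>+x. (\<Sum>n. F n x) * g x \<partial>M) = (\<Sum>n. \<integral>\<^sup>+x. F n x * g x \<partial>M)"
      by (simp flip: ennreal_suminf_multc add: nn_integral_suminf)
    also have "\<dots> \<le> (\<Sum>n. pairing_norm M B (F n))"
      by (intro suminf_le pairing_norm_upper g) auto
    finally show "(\<integral>\<^sup>+x. (\<Sum>n. F n x) * g x \<partial>M) \<le> (\<Sum>n. pairing_norm M B (F n))" .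
  qed
  show "AE x in M. f x = 0"
    if [measurable]: "f \<in> borel_measurable M" and 0: "pairing_norm M B f = 0" for f
  proof (rule AE_coverI[OF A(2)])
    fix n
    obtain c where c: "c > 0" "(\<lambda>x. c * indicator (A n) x) \<in> B" using sat by blast
    have "(\<integral>\<^sup>+x. f x * (c * indicator (A n) x) \<partial>M) = 0"
      using pairing_norm_upper[OF c(2), where M=M and f=f] 0 by simp
    then have "AE x in M. f x * (c * indicator (A n) x) = 0"
      by (subst (asm) nn_integral_0_iff_AE) auto
    then show "AE x in M. x \<in> A n \<longrightarrow> f x = 0"
      by eventually_elim (use c in auto)
  qed
  show "AE x in M. f x < top"
    if [measurable]: "f \<in> borel_measurable M" and fin: "pairing_norm M B f < top" for f
  proof (rule AE_coverI[OF A(2)])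
    fix n
    obtain c where c: "c > 0" "(\<lambda>x. c * indicator (A n) x) \<in> B" using sat by blast
    have "(\<integral>\<^sup>+x. f x * (c * indicator (A n) x) \<partial>M) \<noteq> \<infinity>"
      using pairing_norm_upper[OF c(2), where M=M and f=f] fin by (auto simp: top_unique)
    then have "AE x in M. f x * (c * indicator (A n) x) \<noteq> \<infinity>"
      by (intro nn_integral_noteq_infinite) auto
    then show "AE x in M. x \<in> A n \<longrightarrow> f x < top"
      by eventually_elim (use c in \<open>auto simp: less_top ennreal_mult_eq_top_iff\<close>)
  qed
  show "pairing_norm M B (\<lambda>x. SUP n. F n x) = (SUP n. pairing_norm M B (F n))"
    if [measurable]: "\<And>n. F n \<in> borel_measurable M" and inc: "AE x in M. incseq (\<lambda>n. F n x)"
    for F :: "nat \<Rightarrow> 'a \<Rightarrow> ennreal"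
  proof -
    have "(\<integral>\<^sup>+x. (SUP n. F n x) * g x \<partial>M) = (SUP n. \<integral>\<^sup>+x. F n x * g x \<partial>M)" if "g \<in> B" for g
    proof -
      note [measurable] = Bm[OF that]
      have "AE x in M. \<forall>i. F i x * g x \<le> F (Suc i) x * g x"
        using inc by eventually_elim (auto intro!: mult_right_mono simp: incseq_Suc_iff)
      then have "(\<integral>\<^sup>+x. (SUP n. F n x * g x) \<partial>M) = (SUP n. \<integral>\<^sup>+x. F n x * g x \<partial>M)"
        by (intro nn_integral_monotone_convergence_SUP_AE) auto
      then show ?thesis by (simp add: SUP_mult_right_ennreal)
    qed
    then have "pairing_norm M B (\<lambda>x. SUP n. F n x) = (SUP g\<in>B. SUP n. \<integral>\<^sup>+x. F n x * g x \<partial>M)"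
      by (simp add: pairing_norm_def)
    also have "\<dots> = (SUP n. pairing_norm M B (F n))"
      unfolding pairing_norm_def by (rule SUP_commute)
    finally show ?thesis .
  qed
qed

text \<open>These are the test functions of the associate norm.\<close>

definition unit_ball :: "'a fun_space \<Rightarrow> ('a \<Rightarrow> ennreal) set" where
  "unit_ball X = mag ` {f \<in> elems X. fnorm X f \<le> 1}"

lemma normed_by_associate: "normed_by M (associate M X) (pairing_norm M (unit_ball X))"
proof -
  have "associate_norm M X = (\<lambda>g. pairing_norm M (unit_ball X) (mag g))"
    by (auto simp: associate_norm_def pairing_norm_def unit_ball_def fun_eq_iff image_image mag_def
        e2ennreal_abs_mult mult.commute)
  then show ?thesis unfolding associate_def by (simp add: normed_by_finite_part)
qed

lemma normed_by_unit_ball: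
  assumes Y: "normed_by M Y \<rho>"
  shows "unit_ball Y = {f \<in> borel_measurable M. \<rho> f \<le> 1}"
proof (intro set_eqI iffI)
  fix f assume "f \<in> unit_ball Y"
  then obtain g where g: "g \<in> elems Y" "fnorm Y g \<le> 1" "f = mag g" by (auto simp: unit_ball_def)
  then show "f \<in> {f \<in> borel_measurable M. \<rho> f \<le> 1}"
    using normed_by_norm_le[OF Y g(1), of 1] by (auto simp: normed_by_mem[OF Y])
next
  fix f assume f: "f \<in> {f \<in> borel_measurable M. \<rho> f \<le> 1}"
  then have "(\<lambda>x. enn2ereal (f x)) \<in> elems Y"
    by (auto simp: normed_by_mem[OF Y] intro: le_less_trans)
  with f normed_by_norm_le[OF Y this, of 1] show "f \<in> unit_ball Y"
    unfolding unit_ball_def by (intro image_eqI[of _ _ "\<lambda>x. enn2ereal (f x)"]) auto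
qed

section \<open>The norm of a Banach function space on nonnegative functions\<close>

text \<open>A Banach function space in the present sense may contain a signed function \<open>f\<close> without
  containing \<open>\<bar>f\<bar>\<close>: solidity only speaks about functions dominated by a member.  The functional
  below therefore looks at nonnegative functions only, and \<open>X\<close> itself need not be
  \<open>normed_by\<close> it.\<close>

definition bfs_norm :: "'a fun_space \<Rightarrow> ('a \<Rightarrow> ennreal) \<Rightarrow> ennreal" where
  "bfs_norm X f = (if (\<lambda>x. enn2ereal (f x)) \<in> elems X
     then ennreal (fnorm X (\<lambda>x. enn2ereal (f x))) else top)"

lemma bfs_norm_less_top_iff: "bfs_norm X f < top \<longleftrightarrow> (\<lambda>x. enn2ereal (f x)) \<in> elems X"
  by (simp add: bfs_norm_def)

lemma bfs_norm_unit_ball: "bfs_norm X f \<le> 1 \<Longrightarrow> f \<in> unit_ball X"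
  unfolding unit_ball_def bfs_norm_def
  by (rule image_eqI[of _ _ "\<lambda>x. enn2ereal (f x)"]) (auto split: if_splits simp: top_unique)

locale banach_fs =
  fixes M :: "'a measure" and X :: "'a fun_space"
  assumes banach: "banach_function_space M X"
begin

lemma axioms:
  "elems X \<subseteq> borel_measurable M"
  "\<forall>f\<in>elems X. AE x in M. \<bar>f x\<bar> \<noteq> \<infinity>"
  "\<forall>f\<in>elems X. \<forall>g\<in>borel_measurable M. (AE x in M. f x = g x) \<longrightarrow>
     g \<in> elems X \<and> fnorm X g = fnorm X f"
  "(\<lambda>x. 0) \<in> elems X"
  "\<forall>f\<in>elems X. \<forall>g\<in>elems X. (\<lambda>x. f x + g x) \<in> elems X \<and>
     fnorm X (\<lambda>x. f x + g x) \<le> fnorm X f + fnorm X g"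
  "\<forall>f\<in>elems X. \<forall>c::real. (\<lambda>x. ereal c * f x) \<in> elems X \<and>
     fnorm X (\<lambda>x. ereal c * f x) = \<bar>c\<bar> * fnorm X f"
  "\<forall>f\<in>elems X. 0 \<le> fnorm X f \<and> (fnorm X f = 0 \<longleftrightarrow> (AE x in M. f x = 0))"
  "\<forall>F :: nat \<Rightarrow> 'a \<Rightarrow> ereal. (\<forall>n. F n \<in> elems X) \<and>
     (\<forall>e>0. \<exists>K. \<forall>m\<ge>K. \<forall>n\<ge>K. fnorm X (\<lambda>x. F m x - F n x) < e) \<longrightarrow>
     (\<exists>f\<in>elems X. (\<lambda>n. fnorm X (\<lambda>x. F n x - f x)) \<longlonglongrightarrow> 0)"
  "\<forall>f\<in>borel_measurable M. \<forall>g\<in>elems X. (AE x in M. \<bar>f x\<bar> \<le> g x) \<longrightarrow>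
     f \<in> elems X \<and> fnorm X f = fnorm X (\<lambda>x. \<bar>f x\<bar>) \<and> fnorm X (\<lambda>x. \<bar>f x\<bar>) \<le> fnorm X g"
  using banach unfolding banach_function_space_def ae_banach_space_def
  by - (elim conjE, assumption)+

lemma meas: "f \<in> elems X \<Longrightarrow> f \<in> borel_measurable M"
  by (rule subsetD[OF axioms(1)])

lemma fin: "f \<in> elems X \<Longrightarrow> AE x in M. \<bar>f x\<bar> \<noteq> \<infinity>"
  by (rule axioms(2)[rule_format])

lemma eqv:
  "f \<in> elems X \<Longrightarrow> g \<in> borel_measurable M \<Longrightarrow> AE x in M. f x = g x \<Longrightarrow>
     g \<in> elems X \<and> fnorm X g = fnorm X f"
  by (rule axioms(3)[rule_format])

lemma zero: "(\<lambda>x. 0) \<in> elems X"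
  by (rule axioms(4))

lemma add:
  "f \<in> elems X \<Longrightarrow> g \<in> elems X \<Longrightarrow>
     (\<lambda>x. f x + g x) \<in> elems X \<and> fnorm X (\<lambda>x. f x + g x) \<le> fnorm X f + fnorm X g"
  by (rule axioms(5)[rule_format])

lemma scale:
  "f \<in> elems X \<Longrightarrow>
     (\<lambda>x. ereal c * f x) \<in> elems X \<and> fnorm X (\<lambda>x. ereal c * f x) = \<bar>c\<bar> * fnorm X f"
  by (rule axioms(6)[rule_format])

lemma norm0: "f \<in> elems X \<Longrightarrow> 0 \<le> fnorm X f" "f \<in> elems X \<Longrightarrow> fnorm X f = 0 \<longleftrightarrow> (AE x in M. f x = 0)"
  using axioms(7)[rule_format, of f] by auto

lemma solid:
  "f \<in> borel_measurable M \<Longrightarrow> g \<in> elems X \<Longrightarrow> AE x in M. \<bar>f x\<bar> \<le> g x \<Longrightarrow>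
     f \<in> elems X \<and> fnorm X f \<le> fnorm X g"
  using axioms(9)[rule_format, of f g] by simp

lemma diff: "f \<in> elems X \<Longrightarrow> g \<in> elems X \<Longrightarrow> (\<lambda>x. f x - g x) \<in> elems X"
proof -
  assume f: "f \<in> elems X" and g: "g \<in> elems X"
  have "f x + ereal (-1) * g x = f x - g x" for x
    by (cases "g x") (simp_all add: minus_ereal_def)
  then show ?thesis
    using add[OF f, of "\<lambda>x. ereal (-1) * g x"] scale[OF g, of "-1"] by (simp only:)
qed

lemma norm_minus_commute:
  assumes f: "f \<in> elems X" and g: "g \<in> elems X"
  shows "fnorm X (\<lambda>x. f x - g x) = fnorm X (\<lambda>x. g x - f x)"
proof -
  have "AE x in M. ereal (-1) * (g x - f x) = f x - g x"
    using fin[OF f] fin[OF g]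
  proof eventually_elim
    case (elim x)
    then show ?case by (cases "f x"; cases "g x") auto
  qed
  then have "fnorm X (\<lambda>x. f x - g x) = fnorm X (\<lambda>x. ereal (-1) * (g x - f x))"
    using eqv scale[OF diff[OF g f], of "-1"] meas[OF diff[OF f g]] by blast
  then show ?thesis using scale[OF diff[OF g f], of "-1"] by simp
qed

text \<open>The functional \<open>bfs_norm\<close> recovers the norm of every member that is nonnegative on
  the space; off the space a member may be negative, hence the passage to an a.e. equal function.\<close>

lemma bfs_norm_mag:
  assumes h: "h \<in> borel_measurable M" "\<And>x. x \<in> space M \<Longrightarrow> 0 \<le> h x"
  shows "h \<in> elems X \<longleftrightarrow> bfs_norm X (mag h) < top"
    and "h \<in> elems X \<Longrightarrow> fnorm X h = enn2real (bfs_norm X (mag h))"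
proof -
  let ?h = "\<lambda>x. enn2ereal (mag h x)"
  have "?h x = h x" if "x \<in> space M" for x
    using h(2)[OF that] by (simp add: mag_def enn2ereal_e2ennreal)
  then have AE: "AE x in M. ?h x = h x" "AE x in M. h x = ?h x" by auto
  have "?h \<in> borel_measurable M" using h(1) by measurable
  then have iff: "h \<in> elems X \<longleftrightarrow> ?h \<in> elems X" and eq: "h \<in> elems X \<Longrightarrow> fnorm X h = fnorm X ?h"
    using eqv[of ?h h] eqv[of h ?h] AE h(1) by blast+
  show "h \<in> elems X \<longleftrightarrow> bfs_norm X (mag h) < top"
    using iff by (simp add: bfs_norm_less_top_iff)
  show "fnorm X h = enn2real (bfs_norm X (mag h))" if "h \<in> elems X"
    using that iff eq[OF that] norm0(1) by (simp add: bfs_norm_def)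
qed

lemma bfs_norm_mono:
  assumes "f \<in> borel_measurable M" "AE x in M. f x \<le> g x"
  shows "bfs_norm X f \<le> bfs_norm X g"
proof (cases "(\<lambda>x. enn2ereal (g x)) \<in> elems X")
  case True
  have "AE x in M. \<bar>enn2ereal (f x)\<bar> \<le> enn2ereal (g x)"
    using assms(2) by eventually_elim (simp add: less_eq_ennreal.rep_eq)
  with solid[of "\<lambda>x. enn2ereal (f x)", OF _ True] assms(1) True show ?thesis
    by (auto simp: bfs_norm_def intro: ennreal_leI)
qed (simp add: bfs_norm_def)

lemma bfs_norm_scale:
  assumes c: "c < top"
  shows "bfs_norm X (\<lambda>x. c * f x) = c * bfs_norm X f"
proof -
  obtain r where r: "c = ennreal r" "0 \<le> r" using c by (cases c) auto
  have real_scale: "enn2ereal (ennreal r * a) = ereal r * enn2ereal a" for a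
    using r(2) by (simp add: times_ennreal.rep_eq)
  show ?thesis
  proof (cases "(\<lambda>x. enn2ereal (f x)) \<in> elems X")
    case True
    then show ?thesis
      using scale[OF True, of r] r(2) norm0(1)[OF True]
      by (simp add: bfs_norm_def r(1) real_scale ennreal_mult)
  next
    case False
    show ?thesis
    proof (cases "r = 0")
      case True
      then show ?thesis
        using zero norm0(2)[OF zero] by (simp add: bfs_norm_def r(1) zero_ennreal.rep_eq)
    next
      case nz: False
      have "(\<lambda>x. ereal r * enn2ereal (f x)) \<notin> elems X"
      proof
        assume "(\<lambda>x. ereal r * enn2ereal (f x)) \<in> elems X"
        then have "(\<lambda>x. ereal (1/r) * (ereal r * enn2ereal (f x))) \<in> elems X"
          using scale by blast
        with False nz show False by (simp flip: mult.assoc add: one_ereal_def[symmetric])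
      qed
      with False nz r show ?thesis
        by (simp add: bfs_norm_def real_scale ennreal_mult_top)
    qed
  qed
qed

text \<open>An indicator in the associate space bounds integrals over its set by the norm.  This is the
  only link between convergence in norm and pointwise values of signed members, and it is what
  identifies norm limits below.\<close>

lemma integral_le_associate_norm:
  assumes [measurable]: "A \<in> sets M" and u: "u \<in> elems X" "fnorm X u \<le> e" and e: "0 < e"
  shows "(\<integral>\<^sup>+x. mag u x * indicator A x \<partial>M) \<le> ennreal e * pairing_norm M (unit_ball X) (indicator A)"
proof -
  note [measurable] = meas[OF u(1)]
  let ?C = "pairing_norm M (unit_ball X) (indicator A)"
  have "fnorm X (\<lambda>x. ereal (1/e) * u x) \<le> 1"
    using scale[OF u(1), of "1/e"] u(2) e by simp
  then have "mag (\<lambda>x. ereal (1/e) * u x) \<in> unit_ball X"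
    unfolding unit_ball_def using scale[OF u(1)] by blast
  from pairing_norm_upper[OF this, of M "indicator A"]
  have "(\<integral>\<^sup>+x. indicator A x * (ennreal (1/e) * mag u x) \<partial>M) \<le> ?C"
    using e unfolding mag_scale by simp
  also have "(\<integral>\<^sup>+x. indicator A x * (ennreal (1/e) * mag u x) \<partial>M) =
      ennreal (1/e) * (\<integral>\<^sup>+x. mag u x * indicator A x \<partial>M)"
    by (subst nn_integral_cmult[symmetric]) (auto simp: mult_ac)
  finally have "ennreal e * (ennreal (1/e) * (\<integral>\<^sup>+x. mag u x * indicator A x \<partial>M)) \<le> ennreal e * ?C"
    by (rule mult_left_mono) simp
  then show ?thesis
    using e by (simp flip: mult.assoc ennreal_mult)
qed

text \<open>If an increasing sequence of members converges in norm, then every term lies below the limit: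
  the positive part of \<open>s n - h\<close> is dominated by all later differences \<open>s m - h\<close>, whose
  integrals over each \<open>A k\<close> tend to zero.\<close>

lemma increasing_le_norm_limit:
  fixes A :: "nat \<Rightarrow> 'a set"
  assumes A: "\<And>k. A k \<in> sets M" "(\<Union>k. A k) = space M"
    and loc: "\<And>k. indicator (A k) \<in> elems (associate M X)"
    and s: "\<And>n. s n \<in> elems X" "\<And>m n x. n \<le> m \<Longrightarrow> s n x \<le> s m x"
    and h: "h \<in> elems X" "(\<lambda>n. fnorm X (\<lambda>x. s n x - h x)) \<longlonglongrightarrow> 0"
  shows "AE x in M. s n x \<le> h x"
proof (rule AE_coverI[OF A(2)])
  fix k
  note [measurable] = A(1) meas[OF h(1)] meas[OF s(1)]
  obtain c where c: "pairing_norm M (unit_ball X) (indicator (A k)) = ennreal c" "0 \<le> c"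
  proof -
    have "pairing_norm M (unit_ball X) (indicator (A k)) < top"
      using loc[of k] normed_by_associate[of M X] by (simp add: normed_by_mem)
    then show ?thesis
      using that by (cases "pairing_norm M (unit_ball X) (indicator (A k))") auto
  qed
  define I where "I = (\<integral>\<^sup>+x. e2ennreal (s n x - h x) * indicator (A k) x \<partial>M)"
  have I_le: "I \<le> ennreal (e * c)" if "e > 0" for e :: real
  proof -
    obtain N where N: "\<And>m. m \<ge> N \<Longrightarrow> norm (fnorm X (\<lambda>x. s m x - h x) - 0) < e"
      using LIMSEQ_D[OF h(2) \<open>e > 0\<close>] by blast
    define m where "m = max N n"
    define u where "u x = s m x - h x" for x
    have u_mem: "u \<in> elems X" unfolding u_def[abs_def] by (rule diff[OF s(1) h(1)])
    have u_e: "fnorm X u \<le> e" using N[of m] by (simp add: m_def u_def[abs_def])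
    have "I \<le> (\<integral>\<^sup>+x. mag u x * indicator (A k) x \<partial>M)"
      unfolding I_def
    proof (intro nn_integral_mono mult_right_mono)
      fix x
      have "s n x - h x \<le> u x"
        unfolding u_def by (intro ereal_minus_mono order_refl s(2)) (simp add: m_def)
      also have "u x \<le> \<bar>u x\<bar>" by (cases "u x") auto
      finally show "e2ennreal (s n x - h x) \<le> mag u x"
        unfolding mag_def by (rule e2ennreal_mono)
    qed simp
    also have "\<dots> \<le> ennreal e * ennreal c"
      unfolding c(1)[symmetric] by (rule integral_le_associate_norm[OF A(1) u_mem u_e that])
    finally show ?thesis using that c(2) by (simp add: ennreal_mult)
  qed
  have "I \<le> ennreal (1 * c)" by (rule I_le) simp
  then have "I < top" by (auto intro: le_less_trans)
  then obtain i where i: "I = ennreal i" "0 \<le> i" by (cases I) auto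
  have "i \<le> 0 + e" if "e > 0" for e
  proof -
    have "i \<le> e / (c + 1) * c"
      using I_le[of "e / (c + 1)"] c(2) that i by (simp del: ennreal_le_iff2)
    also have "\<dots> \<le> e" using c(2) that by (simp add: field_simps)
    finally show ?thesis by simp
  qed
  then have "i \<le> 0" by (rule field_le_epsilon)
  then have "I = 0" using i by simp
  then have "AE x in M. e2ennreal (s n x - h x) * indicator (A k) x = 0"
    unfolding I_def by (subst (asm) nn_integral_0_iff_AE) auto
  with fin[OF s(1)[of n]] fin[OF h(1)] show "AE x in M. x \<in> A k \<longrightarrow> s n x \<le> h x"
  proof eventually_elim
    case (elim x)
    show ?case
    proof
      assume "x \<in> A k"
      moreover obtain b b' where "s n x = ereal b" "h x = ereal b'"
        using elim by (metis ereal_real)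
      ultimately show "s n x \<le> h x" using elim by (simp add: ennreal_eq_0_iff)
    qed
  qed
qed

text \<open>Riesz--Fischer: the partial sums form a Cauchy sequence, so they have a norm limit \<open>h\<close>;
  the previous lemma puts the whole series below \<open>h\<close>, and solidity applies.\<close>

lemma bfs_norm_series:
  fixes F :: "nat \<Rightarrow> 'a \<Rightarrow> ennreal" and A :: "nat \<Rightarrow> 'a set"
  assumes A: "\<And>k. A k \<in> sets M" "(\<Union>k. A k) = space M"
    and loc: "\<And>k. indicator (A k) \<in> elems (associate M X)"
    and [measurable]: "\<And>n. F n \<in> borel_measurable M"
  shows "bfs_norm X (\<lambda>x. \<Sum>n. F n x) \<le> (\<Sum>n. bfs_norm X (F n))"
proof (cases "(\<Sum>n. bfs_norm X (F n)) < top")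
  case fin_sum: True
  have F_fin: "bfs_norm X (F n) < top" for n
    using ennreal_suminf_lessD[OF fin_sum] .
  define G where "G n x = enn2ereal (F n x)" for n x
  have G_mem: "G n \<in> elems X" for n
    using F_fin[of n] unfolding bfs_norm_less_top_iff G_def .
  define a where "a n = fnorm X (G n)" for n
  have a0: "0 \<le> a n" for n unfolding a_def by (rule norm0(1)[OF G_mem])
  have bfs_a: "bfs_norm X (F n) = ennreal (a n)" for n
    using G_mem[of n] by (simp add: bfs_norm_def a_def G_def[abs_def])
  have summ: "summable a"
    using fin_sum a0 by (intro summable_suminf_not_top) (auto simp: bfs_a less_top)
  have sum_a: "(\<Sum>n. bfs_norm X (F n)) = ennreal (suminf a)"
    using summ a0 by (simp add: bfs_a suminf_ennreal2)
  define s where "s n x = (\<Sum>i<n. G i x)" for n x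
  have part: "(\<lambda>x. \<Sum>i\<in>I. G i x) \<in> elems X \<and> fnorm X (\<lambda>x. \<Sum>i\<in>I. G i x) \<le> (\<Sum>i\<in>I. a i)"
    if "finite I" for I
    using that
  proof induction
    case empty
    then show ?case using zero norm0(2)[OF zero] by simp
  next
    case (insert i I)
    then show ?case
      using add[OF G_mem[of i], of "\<lambda>x. \<Sum>i\<in>I. G i x"] by (auto simp: a_def)
  qed
  have s_mem: "s n \<in> elems X" and s_norm: "fnorm X (s n) \<le> suminf a" for n
  proof -
    show "s n \<in> elems X" unfolding s_def[abs_def] using part[of "{..<n}"] by simp
    show "fnorm X (s n) \<le> suminf a"
      unfolding s_def[abs_def] using part[of "{..<n}"] sum_le_suminf[OF summ, of "{..<n}"] a0
      by simp
  qed
  have s_mono: "s n x \<le> s m x" if "n \<le> m" for m n x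
    unfolding s_def using that by (intro sum_mono2) (auto simp: G_def)
  have G_fin: "AE x in M. \<forall>i. \<bar>G i x\<bar> \<noteq> \<infinity>"
    unfolding AE_all_countable using fin G_mem by blast
  have s_diff: "fnorm X (\<lambda>x. s m x - s n x) \<le> (\<Sum>i\<in>{n..<m}. a i)" if "n \<le> m" for m n
  proof -
    have "AE x in M. (\<Sum>i\<in>{n..<m}. G i x) = s m x - s n x"
      using G_fin
    proof eventually_elim
      case (elim x)
      then have "\<exists>b. \<forall>i. G i x = ereal (b i)" by (intro choice) (metis ereal_real)
      then obtain b where "\<And>i. G i x = ereal (b i)" by blast
      moreover have "(\<Sum>i<m. b i) = (\<Sum>i<n. b i) + (\<Sum>i\<in>{n..<m}. b i)"
        using that by (metis lessThan_atLeast0 sum.atLeastLessThan_concat zero_le)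
      ultimately show ?case by (simp add: s_def)
    qed
    then have "fnorm X (\<lambda>x. s m x - s n x) = fnorm X (\<lambda>x. \<Sum>i\<in>{n..<m}. G i x)"
      using eqv[of "\<lambda>x. \<Sum>i\<in>{n..<m}. G i x" "\<lambda>x. s m x - s n x"] part[of "{n..<m}"]
        meas[OF diff[OF s_mem s_mem, of m n]] by simp
    then show ?thesis using part[of "{n..<m}"] by simp
  qed
  have Cauchy: "\<exists>K. \<forall>m\<ge>K. \<forall>n\<ge>K. fnorm X (\<lambda>x. s m x - s n x) < e" if "e > 0" for e
  proof -
    obtain K where K: "\<And>m n. m \<ge> K \<Longrightarrow> norm (\<Sum>i\<in>{m..<n}. a i) < e"
      using summ \<open>e > 0\<close> unfolding summable_Cauchy by blast
    have "fnorm X (\<lambda>x. s m x - s n x) < e" if "m \<ge> K" "n \<ge> K" for m n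
    proof (cases "n \<le> m")
      case True
      then show ?thesis using s_diff[OF True] K[of n m] that by simp
    next
      case False
      then have "m \<le> n" by simp
      from s_diff[OF this] K[of m n] that show ?thesis
        unfolding norm_minus_commute[OF s_mem s_mem, of m n] by simp
    qed
    then show ?thesis by blast
  qed
  obtain h where h: "h \<in> elems X" "(\<lambda>n. fnorm X (\<lambda>x. s n x - h x)) \<longlonglongrightarrow> 0"
    using axioms(8)[rule_format, of s] s_mem Cauchy by blast
  have S_le: "AE x in M. \<bar>enn2ereal (\<Sum>n. F n x)\<bar> \<le> h x"
  proof -
    have "AE x in M. \<forall>n. s n x \<le> h x"
      unfolding AE_all_countable using increasing_le_norm_limit[OF A loc s_mem s_mono h] by blast
    then show ?thesis
    proof eventually_elim
      case (elim x)
      have 0: "0 \<le> h x" using elim[rule_format, of 0] by (simp add: s_def)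
      have "(\<Sum>i<n. F i x) \<le> e2ennreal (h x)" for n
      proof -
        have "enn2ereal (\<Sum>i<n. F i x) = s n x"
          by (simp add: s_def G_def)
        then show ?thesis using elim 0 by (simp add: less_eq_ennreal.rep_eq enn2ereal_e2ennreal)
      qed
      then have "(\<Sum>n. F n x) \<le> e2ennreal (h x)"
        by (intro suminf_le_const) auto
      then show ?case using 0 by (simp add: less_eq_ennreal.rep_eq enn2ereal_e2ennreal)
    qed
  qed
  have "(\<lambda>x. enn2ereal (\<Sum>n. F n x)) \<in> borel_measurable M" by measurable
  from solid[OF this h(1) S_le]
  have S_mem: "(\<lambda>x. enn2ereal (\<Sum>n. F n x)) \<in> elems X"
    and S_norm: "fnorm X (\<lambda>x. enn2ereal (\<Sum>n. F n x)) \<le> fnorm X h" by auto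
  have "fnorm X h \<le> suminf a + fnorm X (\<lambda>x. s n x - h x)" for n
  proof -
    have "AE x in M. s n x + (h x - s n x) = h x"
      using fin[OF s_mem[of n]] fin[OF h(1)]
    proof eventually_elim
      case (elim x)
      then obtain b b' where "s n x = ereal b" "h x = ereal b'" by (metis ereal_real)
      then show ?case by simp
    qed
    then have "fnorm X h = fnorm X (\<lambda>x. s n x + (h x - s n x))"
      using eqv add[OF s_mem diff[OF h(1) s_mem], of n n] meas[OF h(1)] by blast
    also have "\<dots> \<le> fnorm X (s n) + fnorm X (\<lambda>x. h x - s n x)"
      using add[OF s_mem diff[OF h(1) s_mem], of n n] by blast
    finally show ?thesis
      using s_norm[of n] norm_minus_commute[OF h(1) s_mem, of n] by simp
  qed
  moreover have "(\<lambda>n. suminf a + fnorm X (\<lambda>x. s n x - h x)) \<longlonglongrightarrow> suminf a + 0"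
    by (intro tendsto_intros h)
  ultimately have "fnorm X h \<le> suminf a + 0"
    by (intro LIMSEQ_le_const[of _ "suminf a + 0"]) auto
  with S_norm S_mem show ?thesis
    unfolding sum_a by (simp add: bfs_norm_def ennreal_leI)
qed (simp add: not_less top_unique)

lemma function_norm_bfs_norm:
  fixes A :: "nat \<Rightarrow> 'a set"
  assumes A: "\<And>n. A n \<in> sets M" "(\<Union>n. A n) = space M"
    and loc: "\<And>n. indicator (A n) \<in> elems (associate M X)"
  shows "function_norm M (bfs_norm X)"
proof
  show "bfs_norm X f \<le> bfs_norm X g"
    if "f \<in> borel_measurable M" "AE x in M. f x \<le> g x" for f g
    using that by (rule bfs_norm_mono)
  show "bfs_norm X (\<lambda>x. c * f x) = c * bfs_norm X f" if "c < top" for f c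
    using that by (rule bfs_norm_scale)
  show "bfs_norm X (\<lambda>x. \<Sum>n. F n x) \<le> (\<Sum>n. bfs_norm X (F n))"
    if "\<And>n. F n \<in> borel_measurable M" for F
    by (rule bfs_norm_series[OF A loc that])
  show "AE x in M. f x = 0" if "bfs_norm X f = 0" for f
  proof -
    have mem: "(\<lambda>x. enn2ereal (f x)) \<in> elems X"
      using that by (auto simp: bfs_norm_def split: if_splits)
    have "fnorm X (\<lambda>x. enn2ereal (f x)) = 0"
      using that mem norm0(1)[OF mem] by (simp add: bfs_norm_def)
    with norm0(2)[OF mem] have "AE x in M. enn2ereal (f x) = 0" by simp
    then show ?thesis unfolding AE_mag_0_iff[symmetric] by simp
  qed
  show "AE x in M. f x < top" if "bfs_norm X f < top" for f
  proof -
    have "AE x in M. \<bar>enn2ereal (f x)\<bar> \<noteq> \<infinity>"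
      using fin that unfolding bfs_norm_less_top_iff by blast
    then show ?thesis unfolding AE_mag_finite_iff[symmetric] by simp
  qed
qed

lemma fatou_norm_bfs_norm:
  assumes fn: "function_norm M (bfs_norm X)" and fat: "fatou_property M X"
  shows "fatou_norm M (bfs_norm X)"
proof -
  interpret N: function_norm M "bfs_norm X" by fact
  show ?thesis
  proof
    fix F :: "nat \<Rightarrow> 'a \<Rightarrow> ennreal"
    assume [measurable]: "\<And>n. F n \<in> borel_measurable M" and inc: "AE x in M. incseq (\<lambda>n. F n x)"
    let ?S = "\<lambda>x. SUP n. F n x"
    have ge: "(SUP n. bfs_norm X (F n)) \<le> bfs_norm X ?S"
      by (intro SUP_least N.mono) (auto intro!: AE_I2 SUP_upper)
    show "bfs_norm X ?S = (SUP n. bfs_norm X (F n))"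
    proof (cases "(SUP n. bfs_norm X (F n)) < top")
      case True
      have mem: "(\<lambda>x. enn2ereal (F n x)) \<in> elems X" for n
        using le_less_trans[OF SUP_upper True, of n] by (simp add: bfs_norm_less_top_iff)
      define a where "a n = fnorm X (\<lambda>x. enn2ereal (F n x))" for n
      have a0: "0 \<le> a n" for n
        unfolding a_def by (rule norm0(1)[OF mem])
      have a: "bfs_norm X (F n) = ennreal (a n)" for n
        using mem[of n] by (simp add: bfs_norm_def a_def)
      obtain C where C: "(SUP n. bfs_norm X (F n)) = ennreal C" "0 \<le> C"
        using True by (cases "SUP n. bfs_norm X (F n)") auto
      have inc_rho: "incseq (\<lambda>n. bfs_norm X (F n))"
        by (auto simp: mono_def intro!: N.mono eventually_mono[OF inc])
      then have inc_a: "incseq a"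
        using a0 by (simp add: a mono_def)
      have "a n \<le> C" for n
        using SUP_upper[of n UNIV "\<lambda>n. bfs_norm X (F n)"] C by (simp add: a)
      then obtain L where "a \<longlonglongrightarrow> L" using incseq_convergent[OF inc_a] by blast
      then have conv: "convergent a" by (auto simp: convergent_def)
      have "AE x in M. incseq (\<lambda>n. enn2ereal (F n x)) \<and>
          (\<lambda>n. enn2ereal (F n x)) \<longlonglongrightarrow> enn2ereal (?S x)"
        using inc
      proof eventually_elim
        case (elim x)
        then show ?case
          by (auto simp: mono_def less_eq_ennreal.rep_eq intro!: tendsto_enn2erealI LIMSEQ_SUP)
      qed
      moreover have "(\<lambda>x. enn2ereal (?S x)) \<in> borel_measurable M" by measurable
      ultimately have S: "(\<lambda>x. enn2ereal (?S x)) \<in> elems X"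
        and lim: "a \<longlonglongrightarrow> fnorm X (\<lambda>x. enn2ereal (?S x))"
        using fat[unfolded fatou_property_def, rule_format,
            of "\<lambda>x. enn2ereal (?S x)" "\<lambda>n x. enn2ereal (F n x)"] mem conv
        unfolding a_def[abs_def] by auto
      have "(\<lambda>n. bfs_norm X (F n)) \<longlonglongrightarrow> bfs_norm X ?S"
        unfolding a using lim S by (simp add: bfs_norm_def tendsto_ennrealI)
      then show ?thesis
        using LIMSEQ_unique LIMSEQ_SUP[OF inc_rho] by blast
    next
      case False
      then have "(SUP n. bfs_norm X (F n)) = top" using less_top by blast
      with ge show ?thesis by (simp only: top_unique)
    qed
  qed
qed

end

section \<open>The Lorentz--Luxemburg theorem\<close>

lemma (in function_norm) unit_ball_convex:
  fixes u v :: "'a \<Rightarrow> real"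
  assumes [measurable]: "u \<in> borel_measurable M" "v \<in> borel_measurable M"
    and nn: "\<And>x. 0 \<le> u x" "\<And>x. 0 \<le> v x"
    and le: "\<rho> (\<lambda>x. ennreal (u x)) \<le> 1" "\<rho> (\<lambda>x. ennreal (v x)) \<le> 1"
    and t: "0 \<le> t" "t \<le> 1"
  shows "\<rho> (\<lambda>x. ennreal ((1 - t) * u x + t * v x)) \<le> 1"
proof -
  have "\<rho> (\<lambda>x. ennreal ((1 - t) * u x + t * v x)) =
      \<rho> (\<lambda>x. ennreal (1 - t) * ennreal (u x) + ennreal t * ennreal (v x))"
    using nn t by (simp add: ennreal_plus ennreal_mult)
  also have "\<dots> \<le> \<rho> (\<lambda>x. ennreal (1 - t) * ennreal (u x)) + \<rho> (\<lambda>x. ennreal t * ennreal (v x))"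
    by (rule add) auto
  also have "\<dots> = ennreal (1 - t) * \<rho> (\<lambda>x. ennreal (u x)) + ennreal t * \<rho> (\<lambda>x. ennreal (v x))"
    by (simp add: scale)
  also have "\<dots> \<le> ennreal (1 - t) * 1 + ennreal t * 1"
    by (intro add_mono mult_left_mono le) auto
  also have "\<dots> = 1"
    using t by (simp flip: ennreal_plus)
  finally show ?thesis .
qed

lemma integrable_bounded_support:
  fixes u :: "'a \<Rightarrow> real"
  assumes "u \<in> borel_measurable M" "B \<in> sets M" "emeasure M B < top"
    and "\<And>x. \<bar>u x\<bar> \<le> L * indicator B x"
  shows "integrable M u"
proof (rule Bochner_Integration.integrable_bound)
  show "integrable M (\<lambda>x. L * indicator B x :: real)"
    using assms by (intro integrable_mult_right integrable_real_indicator) auto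
  show "AE x in M. norm (u x) \<le> norm (L * indicator B x :: real)"
    using assms(4) by (intro AE_I2) (simp add: order_trans[OF _ abs_ge_self])
qed (rule assms)

text \<open>Inside this locale \<open>\<phi>\<close> is bounded with support in a set of finite measure, so every function
  between \<open>0\<close> and \<open>\<phi>\<close> is square integrable and the geometry of \<open>L\<^sup>2\<close> can be used with
  ordinary integrals of real functions.\<close>

locale bounded_truncation = fatou_norm +
  fixes \<phi> :: "'a \<Rightarrow> real" and K :: real and B :: "'a set"
  assumes \<phi>_meas [measurable]: "\<phi> \<in> borel_measurable M"
    and \<phi>_nonneg: "0 \<le> \<phi> x" and \<phi>_le: "\<phi> x \<le> K * indicator B x"
    and B_sets [measurable]: "B \<in> sets M" and B_finite: "emeasure M B < top"
begin

text \<open>The part of the unit ball below \<open>\<phi>\<close>.  Cutting off at \<open>\<phi>\<close> only decreases the distance to \<open>\<phi>\<close>, so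
  the minimum over the candidates is the minimum over the whole ball.\<close>

definition candidates :: "('a \<Rightarrow> real) set" where
  "candidates = {h \<in> borel_measurable M. (\<forall>x. 0 \<le> h x \<and> h x \<le> \<phi> x) \<and> \<rho> (\<lambda>x. ennreal (h x)) \<le> 1}"

definition sqdist :: "('a \<Rightarrow> real) \<Rightarrow> real" where
  "sqdist h = (\<integral>x. (\<phi> x - h x)\<^sup>2 \<partial>M)"

lemma bd_mult:
  fixes u v L L' :: real
  assumes "\<bar>u\<bar> \<le> L * indicator B x" "\<bar>v\<bar> \<le> L' * indicator B x"
  shows "\<bar>u * v\<bar> \<le> (L * L') * (indicator B x :: real)"
  using mult_mono[OF assms] assms by (cases "x \<in> B") (auto simp: abs_mult)

lemma integrable_mult_bd:
  fixes u v :: "'a \<Rightarrow> real" and L L' :: real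
  assumes [measurable]: "u \<in> borel_measurable M" "v \<in> borel_measurable M"
    and "\<And>x. \<bar>u x\<bar> \<le> L * indicator B x" "\<And>x. \<bar>v x\<bar> \<le> L' * indicator B x"
  shows "integrable M (\<lambda>x. u x * v x)"
proof (rule integrable_bounded_support[OF _ B_sets B_finite, where L="L * L'"])
  show "\<bar>u x * v x\<bar> \<le> L * L' * indicator B x" for x
    by (rule bd_mult) fact+
qed measurable

lemma candidatesD:
  assumes "h \<in> candidates"
  shows "h \<in> borel_measurable M" "0 \<le> h x" "h x \<le> \<phi> x" "\<rho> (\<lambda>x. ennreal (h x)) \<le> 1"
    "\<bar>h x\<bar> \<le> K * indicator B x" "\<bar>\<phi> x - h x\<bar> \<le> K * indicator B x"
  using assms \<phi>_le[of x] by (auto simp: candidates_def intro: order_trans)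
    (smt (verit))+

lemma integrable_sqdist:
  assumes h: "h \<in> candidates"
  shows "integrable M (\<lambda>x. (\<phi> x - h x)\<^sup>2)"
proof -
  note [measurable] = candidatesD(1)[OF h]
  show ?thesis
    unfolding power2_eq_square
    by (rule integrable_mult_bd[OF _ _ candidatesD(6)[OF h] candidatesD(6)[OF h]]) measurable
qed

lemma sqdist_nonneg: "0 \<le> sqdist h"
  unfolding sqdist_def by simp

lemma candidates_midpoint:
  assumes g: "g \<in> candidates" and h: "h \<in> candidates"
  shows "(\<lambda>x. (g x + h x) / 2) \<in> candidates"
proof -
  have "(1 - 1/2) * g x + 1/2 * h x = (g x + h x) / 2" for x
    by (simp add: field_simps)
  moreover have "\<rho> (\<lambda>x. ennreal ((1 - 1/2) * g x + 1/2 * h x)) \<le> 1"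
    by (rule unit_ball_convex) (auto intro: candidatesD g h)
  ultimately have "\<rho> (\<lambda>x. ennreal ((g x + h x) / 2)) \<le> 1" by (simp only:)
  moreover have "(g x + h x) / 2 \<le> \<phi> x" for x
    using candidatesD(3)[OF g, of x] candidatesD(3)[OF h, of x] by simp
  ultimately show ?thesis
    using candidatesD(1,2)[OF g] candidatesD(1,2)[OF h] by (auto simp: candidates_def)
qed

lemma parallelogram:
  assumes g: "g \<in> candidates" and h: "h \<in> candidates"
  shows "(\<integral>x. (g x - h x)\<^sup>2 \<partial>M) = 2 * sqdist g + 2 * sqdist h - 4 * sqdist (\<lambda>x. (g x + h x) / 2)"
proof -
  note int = integrable_sqdist[OF g] integrable_sqdist[OF h] integrable_sqdist[OF candidates_midpoint[OF g h]]
  have "(\<integral>x. (g x - h x)\<^sup>2 \<partial>M) =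
      (\<integral>x. 2 * (\<phi> x - g x)\<^sup>2 + 2 * (\<phi> x - h x)\<^sup>2 - 4 * (\<phi> x - (g x + h x) / 2)\<^sup>2 \<partial>M)"
    by (rule Bochner_Integration.integral_cong) (auto simp: power2_eq_square field_simps)
  also have "\<dots> = 2 * sqdist g + 2 * sqdist h - 4 * sqdist (\<lambda>x. (g x + h x) / 2)"
    unfolding sqdist_def using int by simp
  finally show ?thesis .
qed

text \<open>By the parallelogram law the steps of a minimising sequence are of size at most
  \<open>2 * (1/2)^k\<close> in \<open>L\<^sup>2\<close>, hence of order \<open>(1/2)^k\<close> in \<open>L\<^sup>1\<close> on \<open>B\<close>, and therefore
  summable a.e.\<close>

lemma AE_convergent_if_fast:
  assumes h: "\<And>k. h k \<in> candidates" and d: "\<And>g. g \<in> candidates \<Longrightarrow> d \<le> sqdist g"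
    and sqdist: "\<And>k. sqdist (h k) < d + (1/4)^k"
  shows "AE x in M. convergent (\<lambda>k. h k x)"
proof -
  define m where "m = measure M B"
  note [measurable] = candidatesD(1)[OF h]
  let ?u = "\<lambda>k x. h (Suc k) x - h k x"
  have u_bd: "\<bar>?u k x\<bar> \<le> K * indicator B x" for k x
    using candidatesD(2,3)[OF h, of k x] candidatesD(2,3)[OF h, of "Suc k" x] \<phi>_le[of x] by linarith
  have int_u: "integrable M (?u k)" for k
    by (rule integrable_bounded_support[OF _ B_sets B_finite u_bd]) simp
  have int_u2: "integrable M (\<lambda>x. (?u k x)\<^sup>2)" for k
    unfolding power2_eq_square by (rule integrable_mult_bd[OF _ _ u_bd u_bd]) auto
  have u2: "(\<integral>x. (?u k x)\<^sup>2 \<partial>M) \<le> 4 * (1/4)^k" for k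
  proof -
    have "2 * a + 2 * b - 4 * c \<le> 2 * (d + e) + 2 * (d + e') - 4 * d"
      if "a < d + e" "b < d + e'" "d \<le> c" for a b c e e' :: real
      using that by (simp add: algebra_simps)
    from this[OF sqdist[of "Suc k"] sqdist[of k] d[OF candidates_midpoint[OF h h]]]
    have "(\<integral>x. (?u k x)\<^sup>2 \<partial>M) \<le> 2 * (d + (1/4)^Suc k) + 2 * (d + (1/4)^k) - 4 * d"
      unfolding parallelogram[OF h h] .
    also have "\<dots> \<le> 4 * (1/4)^k" by simp
    finally show ?thesis .
  qed
  have u1: "(\<integral>x. \<bar>?u k x\<bar> \<partial>M) \<le> (4 + m) * (1/2)^k" for k
  proof -
    have "(\<integral>x. \<bar>?u k x\<bar> \<partial>M) \<le> (\<integral>x. 2^k * (?u k x)\<^sup>2 + (1/2)^k * indicator B x \<partial>M)"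
    proof (rule integral_mono)
      show "integrable M (\<lambda>x. 2^k * (?u k x)\<^sup>2 + (1/2)^k * indicator B x)"
        using int_u2 B_finite by (intro Bochner_Integration.integrable_add integrable_mult_right
            integrable_real_indicator) auto
      fix x
      \<comment> \<open>The inequality \<open>a \<le> 2^k * a^2 + 2^-k\<close> replaces Cauchy--Schwarz on \<open>B\<close>.\<close>
      show "\<bar>?u k x\<bar> \<le> 2^k * (?u k x)\<^sup>2 + (1/2)^k * indicator B x"
      proof (cases "x \<in> B")
        case True
        define a where "a = \<bar>?u k x\<bar>"
        have "0 \<le> (2^k * a - 1)\<^sup>2" by simp
        then have "2 * (2^k * a) \<le> 2^k * 2^k * a\<^sup>2 + 1"
          by (simp add: power2_eq_square algebra_simps)
        moreover have "0 \<le> 2^k * a" by (simp add: a_def)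
        ultimately have "2^k * a \<le> 2^k * 2^k * a\<^sup>2 + 1" by linarith
        also have "\<dots> = 2^k * (2^k * a\<^sup>2 + (1/2)^k)"
          by (simp add: algebra_simps power_divide)
        finally have "a \<le> 2^k * a\<^sup>2 + (1/2)^k"
          by (rule mult_left_le_imp_le) simp
        then show ?thesis using True by (simp add: a_def)
      qed (use u_bd[of k x] in auto)
    qed (use int_u in auto)
    also have "\<dots> = 2^k * (\<integral>x. (?u k x)\<^sup>2 \<partial>M) + (1/2)^k * m"
      using int_u2 B_finite by (simp add: m_def)
    also have "\<dots> \<le> 2^k * (4 * (1/4)^k) + (1/2)^k * m"
      by (intro add_right_mono mult_left_mono u2) auto
    also have "2^k * (4 * (1/4)^k) = 4 * (1/2::real)^k"
      by (simp add: power_divide power_mult_distrib[symmetric] flip: power_mult_distrib)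
        (simp add: field_simps flip: power_mult_distrib)
    finally show ?thesis by (simp add: algebra_simps)
  qed
  have "(\<integral>\<^sup>+x. (\<Sum>k. ennreal \<bar>?u k x\<bar>) \<partial>M) = (\<Sum>k. \<integral>\<^sup>+x. ennreal \<bar>?u k x\<bar> \<partial>M)"
    by (rule nn_integral_suminf) simp
  also have "\<dots> = (\<Sum>k. ennreal (\<integral>x. \<bar>?u k x\<bar> \<partial>M))"
    using int_u by (simp add: nn_integral_eq_integral)
  also have "\<dots> \<le> (\<Sum>k. ennreal ((4 + m) * (1/2)^k))"
    by (intro suminf_le ennreal_leI u1) auto
  also have "\<dots> = ennreal (\<Sum>k. (4 + m) * (1/2)^k)"
    by (rule suminf_ennreal2) (auto simp: m_def intro!: summable_mult)
  also have "\<dots> < \<infinity>" by simp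
  finally have "AE x in M. (\<Sum>k. ennreal \<bar>?u k x\<bar>) \<noteq> \<infinity>"
    by (intro nn_integral_noteq_infinite) auto
  then show ?thesis
  proof eventually_elim
    case (elim x)
    have "summable (\<lambda>k. \<bar>?u k x\<bar>)"
      using elim by (intro summable_suminf_not_top) auto
    then have "summable (\<lambda>k. ?u k x)" by (rule summable_rabs_cancel)
    then have "convergent (\<lambda>n. h n x - h 0 x)"
      unfolding summable_iff_convergent by (simp only: sum_lessThan_telescope[of "\<lambda>k. h k x"])
    then show ?case by (rule convergent_diff_const_right_iff[THEN iffD1])
  qed
qed

text \<open>The limit of a fast minimising sequence is taken as a lower limit, which exists everywhere and
  stays in the unit ball: it is an increasing limit of infima, and the Fatou property applies.\<close>

lemma minimiser_exists: "\<exists>p\<in>candidates. \<forall>h\<in>candidates. sqdist p \<le> sqdist h"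
proof -
  define d where "d = Inf (sqdist ` candidates)"
  have bdd: "bdd_below (sqdist ` candidates)" using sqdist_nonneg by (intro bdd_belowI2) auto
  have "(\<lambda>x. 0) \<in> candidates" by (simp add: candidates_def \<phi>_nonneg)
  then have ne: "sqdist ` candidates \<noteq> {}" by blast
  have d: "d \<le> sqdist g" if "g \<in> candidates" for g
    unfolding d_def using bdd that by (intro cInf_lower) auto
  have "\<exists>h. h \<in> candidates \<and> sqdist h < d + (1/4)^k" for k
    using cInf_lessD[OF ne, of "d + (1/4)^k"] by (auto simp: d_def)
  then obtain h where h: "\<And>k. h k \<in> candidates" and sqdist: "\<And>k. sqdist (h k) < d + (1/4)^k" by metis
  note [measurable] = candidatesD(1)[OF h]
  define F where "F n x = (INF k\<in>{n..}. ennreal (h k x))" for n x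
  have [measurable]: "F n \<in> borel_measurable M" for n
    unfolding F_def by measurable
  have inc: "incseq (\<lambda>n. F n x)" for x
    unfolding F_def mono_def by (auto intro!: INF_superset_mono)
  define P where "P x = (SUP n. F n x)" for x
  have [measurable]: "P \<in> borel_measurable M" unfolding P_def by measurable
  have P_le: "P x \<le> ennreal (\<phi> x)" for x
    unfolding P_def F_def
    by (intro SUP_least INF_lower2[of n for n] ennreal_leI candidatesD(3)[OF h]) auto
  define p where "p x = enn2real (P x)" for x
  have P_p: "P x = ennreal (p x)" for x
    unfolding p_def by (rule ennreal_enn2real[OF le_less_trans[OF P_le ennreal_less_top], symmetric])
  have p_meas [measurable]: "p \<in> borel_measurable M" unfolding p_def by measurable
  have "\<rho> (\<lambda>x. P x) = (SUP n. \<rho> (F n))"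
    unfolding P_def by (rule monotone) (auto simp: inc)
  also have "\<dots> \<le> 1"
  proof (rule SUP_least)
    fix n
    have "\<rho> (F n) \<le> \<rho> (\<lambda>x. ennreal (h n x))"
      unfolding F_def by (rule mono) (auto intro!: INF_lower)
    then show "\<rho> (F n) \<le> 1" using candidatesD(4)[OF h, of n] by (rule order_trans)
  qed
  finally have "\<rho> (\<lambda>x. ennreal (p x)) \<le> 1" by (simp only: P_p)
  moreover have "0 \<le> p x" for x by (simp add: p_def)
  moreover have "p x \<le> \<phi> x" for x
    using P_le[of x] unfolding P_p by (simp add: ennreal_le_iff \<phi>_nonneg)
  ultimately have p_cand: "p \<in> candidates" using p_meas by (simp add: candidates_def)
  have "AE x in M. convergent (\<lambda>k. h k x)"
    by (rule AE_convergent_if_fast[where d=d]) (fact h d sqdist)+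
  then have AE_lim: "AE x in M. (\<lambda>k. h k x) \<longlonglongrightarrow> p x"
  proof eventually_elim
    case (elim x)
    then obtain L where L: "(\<lambda>k. h k x) \<longlonglongrightarrow> L" by (auto simp: convergent_def)
    then have "0 \<le> L"
      using candidatesD(2)[OF h] by (intro LIMSEQ_le_const[of "\<lambda>k. h k x"]) auto
    have "(\<lambda>k. ennreal (h k x)) \<longlonglongrightarrow> ennreal L" using L by (rule tendsto_ennrealI)
    then have "P x = ennreal L"
      using lim_imp_Liminf[of sequentially "\<lambda>k. ennreal (h k x)" "ennreal L"]
      by (simp add: P_def F_def liminf_SUP_INF)
    then show ?case using L \<open>0 \<le> L\<close> by (simp add: p_def)
  qed
  have "(\<lambda>k. sqdist (h k)) \<longlonglongrightarrow> sqdist p"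
    unfolding sqdist_def
  proof (rule integral_dominated_convergence)
    show "integrable M (\<lambda>x. K * K * indicator B x :: real)"
      using B_finite by (intro integrable_mult_right integrable_real_indicator) auto
    show "AE x in M. (\<lambda>k. (\<phi> x - h k x)\<^sup>2) \<longlonglongrightarrow> (\<phi> x - p x)\<^sup>2"
      using AE_lim by eventually_elim (intro tendsto_intros)
    show "AE x in M. norm ((\<phi> x - h k x)\<^sup>2) \<le> K * K * indicator B x" for k
      unfolding power2_eq_square real_norm_def by (intro AE_I2 bd_mult candidatesD(6)[OF h])
  qed auto
  moreover have "(\<lambda>k. d + (1/4)^k) \<longlonglongrightarrow> d + 0"
    by (intro tendsto_intros LIMSEQ_power_zero) auto
  ultimately have "sqdist p \<le> d"
    using sqdist by (intro LIMSEQ_le[of "\<lambda>k. sqdist (h k)" "sqdist p" "\<lambda>k. d + (1/4)^k"]) (auto intro: less_imp_le)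
  then show ?thesis using p_cand d by (meson order_trans)
qed

text \<open>The segment from the minimiser \<open>p\<close> to a point \<open>q\<close> of the ball may leave the candidates, but
  cutting it off at \<open>\<phi>\<close> does not increase the distance.  So the quadratic function
  \<open>t \<mapsto> \<Parallel>\<phi> - (p + t (q - p))\<Parallel>\<^sup>2\<close> on \<open>[0, 1]\<close> is at least its value at \<open>0\<close>, and its slope there is
  nonnegative.\<close>

lemma variational_inequality:
  assumes p: "p \<in> candidates" "\<And>h. h \<in> candidates \<Longrightarrow> sqdist p \<le> sqdist h"
    and q [measurable]: "q \<in> borel_measurable M" and q_bd: "\<And>x. 0 \<le> q x" "\<And>x. q x \<le> L * indicator B x"
    and q_ball: "\<rho> (\<lambda>x. ennreal (q x)) \<le> 1"
  shows "(\<integral>x. (\<phi> x - p x) * (q x - p x) \<partial>M) \<le> 0"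
proof -
  note [measurable] = candidatesD(1)[OF p(1)]
  define k where "k x = \<phi> x - p x" for x
  define r where "r x = q x - p x" for x
  have [measurable]: "k \<in> borel_measurable M" "r \<in> borel_measurable M"
    unfolding k_def r_def by measurable
  have k_bd: "\<bar>k x\<bar> \<le> K * indicator B x" for x
    unfolding k_def by (rule candidatesD(6)[OF p(1)])
  have r_bd: "\<bar>r x\<bar> \<le> (K + L) * indicator B x" for x
    using q_bd[of x] candidatesD(5)[OF p(1), of x] candidatesD(2)[OF p(1), of x]
    unfolding r_def by (simp add: algebra_simps)
  have ikk: "integrable M (\<lambda>x. k x * k x)" and ikr: "integrable M (\<lambda>x. k x * r x)"
    and irr: "integrable M (\<lambda>x. r x * r x)"
    by (rule integrable_mult_bd[OF _ _ k_bd k_bd] integrable_mult_bd[OF _ _ k_bd r_bd]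
        integrable_mult_bd[OF _ _ r_bd r_bd]; simp)+
  define I where "I = (\<integral>x. k x * r x \<partial>M)"
  define S where "S = (\<integral>x. r x * r x \<partial>M)"
  have "S \<ge> 0" unfolding S_def by simp
  have step: "2 * I \<le> t * S" if t: "0 < t" "t \<le> 1" for t
  proof -
    define w where "w x = min (\<phi> x) ((1 - t) * p x + t * q x)" for x
    have [measurable]: "w \<in> borel_measurable M" unfolding w_def by measurable
    have cvx: "\<rho> (\<lambda>x. ennreal ((1 - t) * p x + t * q x)) \<le> 1"
      by (rule unit_ball_convex) (use t q_bd q_ball candidatesD[OF p(1)] in auto)
    have "\<rho> (\<lambda>x. ennreal (w x)) \<le> \<rho> (\<lambda>x. ennreal ((1 - t) * p x + t * q x))"
      by (rule mono) (auto simp: w_def intro!: ennreal_leI)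
    then have w: "w \<in> candidates"
      using cvx t q_bd(1) candidatesD(2)[OF p(1)] \<phi>_nonneg
      by (auto simp: candidates_def w_def)
    have "(\<phi> x - w x)\<^sup>2 \<le> k x * k x - 2 * t * (k x * r x) + t * t * (r x * r x)" for x
    proof -
      have "(\<phi> x - w x)\<^sup>2 \<le> (k x - t * r x)\<^sup>2"
      proof (rule abs_le_square_iff[THEN iffD1])
        show "\<bar>\<phi> x - w x\<bar> \<le> \<bar>k x - t * r x\<bar>"
          unfolding w_def k_def r_def by (simp add: algebra_simps min_def)
      qed
      then show ?thesis by (simp add: power2_eq_square algebra_simps)
    qed
    then have "sqdist w \<le> (\<integral>x. k x * k x - 2 * t * (k x * r x) + t * t * (r x * r x) \<partial>M)"
      unfolding sqdist_def using integrable_sqdist[OF w] ikk ikr irr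
      by (intro integral_mono) auto
    also have "\<dots> = sqdist p - 2 * t * I + t * t * S"
      using ikk ikr irr by (simp add: sqdist_def I_def S_def power2_eq_square k_def)
    finally have "sqdist w \<le> sqdist p - 2 * t * I + t * t * S" .
    with p(2)[OF w] have "t * (2 * I) \<le> t * (t * S)" by (simp add: algebra_simps)
    then show ?thesis using t by simp
  qed
  have "I \<le> 0"
  proof (rule ccontr)
    assume "\<not> I \<le> 0"
    then have "0 < I" by simp
    define t where "t = min 1 (I / (S + 1))"
    have t: "0 < t" "t \<le> 1" "t \<le> I / (S + 1)"
      using \<open>0 < I\<close> \<open>S \<ge> 0\<close> by (auto simp: t_def)
    have "2 * I \<le> t * S" by (rule step) fact+
    also have "\<dots> \<le> I / (S + 1) * S"
      using t(3) \<open>S \<ge> 0\<close> by (rule mult_right_mono)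
    also have "\<dots> \<le> I"
      using \<open>0 < I\<close> \<open>S \<ge> 0\<close> by (simp add: field_simps)
    finally show False using \<open>0 < I\<close> by simp
  qed
  then show ?thesis by (simp add: I_def k_def r_def)
qed

text \<open>With \<open>k = \<phi> - p \<ge> 0\<close> and \<open>c = \<integral> k p\<close>, the variational inequality gives \<open>\<integral> k q \<le> c\<close> on the
  ball, while \<open>\<integral> k \<phi> = c + \<integral> k^2 > c\<close>; so \<open>k / c\<close> separates.  Here \<open>c > 0\<close>, as otherwise \<open>k\<close>
  would vanish on \<open>B\<close> when tested with a small multiple of the indicator of \<open>B\<close>.\<close>

lemma separating_function:
  assumes ind: "\<rho> (indicator B) < top" and \<phi>1: "1 < \<rho> (\<lambda>x. ennreal (\<phi> x))"
  shows "\<exists>g\<in>borel_measurable M.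
    (\<forall>h\<in>borel_measurable M. \<rho> h \<le> 1 \<longrightarrow> (\<integral>\<^sup>+x. h x * g x \<partial>M) \<le> 1) \<and>
    1 < (\<integral>\<^sup>+x. ennreal (\<phi> x) * g x \<partial>M)"
proof -
  obtain p where p: "p \<in> candidates" "\<And>h. h \<in> candidates \<Longrightarrow> sqdist p \<le> sqdist h"
    using minimiser_exists by blast
  note [measurable] = candidatesD(1)[OF p(1)]
  define k where "k x = \<phi> x - p x" for x
  have [measurable]: "k \<in> borel_measurable M" unfolding k_def by measurable
  have k_bd: "\<bar>k x\<bar> \<le> K * indicator B x" and k_nn: "0 \<le> k x" for x
    unfolding k_def using candidatesD(3,6)[OF p(1), of x] by auto
  have k_off: "k x = 0" if "x \<notin> B" for x using k_bd[of x] that by simp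
  have p_bd: "\<bar>p x\<bar> \<le> K * indicator B x" for x
    by (rule candidatesD(5)[OF p(1)])
  have ikk: "integrable M (\<lambda>x. k x * k x)" and ikp: "integrable M (\<lambda>x. k x * p x)"
    by (rule integrable_mult_bd[OF _ _ k_bd k_bd] integrable_mult_bd[OF _ _ k_bd p_bd]; simp)+
  define c where "c = (\<integral>x. k x * p x \<partial>M)"
  have c0: "0 \<le> c"
    unfolding c_def using k_nn candidatesD(2)[OF p(1)] by simp
  have bound: "(\<integral>x. k x * q x \<partial>M) \<le> c"
    if [measurable]: "q \<in> borel_measurable M" and q: "\<And>x. 0 \<le> q x" "\<And>x. q x \<le> L * indicator B x"
      "\<rho> (\<lambda>x. ennreal (q x)) \<le> 1" for q L
  proof -
    have q_bd: "\<bar>q x\<bar> \<le> L * indicator B x" for x using q(1,2)[of x] by simp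
    have ikq: "integrable M (\<lambda>x. k x * q x)"
      by (rule integrable_mult_bd[OF _ _ k_bd q_bd]) auto
    have "(\<integral>x. k x * (q x - p x) \<partial>M) \<le> 0"
      unfolding k_def by (rule variational_inequality[OF p _ q]) auto
    then show ?thesis using ikq ikp by (simp add: right_diff_distrib c_def)
  qed
  have kk_pos: "0 < (\<integral>x. k x * k x \<partial>M)"
  proof (rule ccontr)
    assume "\<not> ?thesis"
    then have "(\<integral>x. k x * k x \<partial>M) = 0" using k_nn by (simp add: not_less order_antisym)
    then have "AE x in M. k x * k x = 0"
      using integral_nonneg_eq_0_iff_AE[OF ikk] k_nn by simp
    then have "\<rho> (\<lambda>x. ennreal (\<phi> x)) = \<rho> (\<lambda>x. ennreal (p x))"
      by (intro cong) (auto simp: k_def)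
    then show False using \<phi>1 candidatesD(4)[OF p(1)] by simp
  qed
  have bound': "(\<integral>\<^sup>+x. h x * ennreal (k x) \<partial>M) \<le> ennreal c"
    if [measurable]: "h \<in> borel_measurable M" and h: "\<rho> h \<le> 1" for h
  proof -
    define q where "q n x = enn2real (min (h x) (of_nat n)) * indicator B x" for n x
    have [measurable]: "q n \<in> borel_measurable M" for n unfolding q_def by measurable
    have q_eq: "ennreal (q n x) = min (h x) (of_nat n) * indicator B x" for n x
    proof -
      have "min (h x) (of_nat n) < top" by (simp add: min_less_iff_disj of_nat_less_top)
      then show ?thesis by (cases "x \<in> B") (simp_all add: q_def)
    qed
    have qk: "(\<integral>\<^sup>+x. min (h x) (of_nat n) * ennreal (k x) \<partial>M) \<le> ennreal c" for n
    proof -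
      have q_nn: "0 \<le> q n x" for x by (simp add: q_def)
      have q_le: "q n x \<le> real n * indicator B x" for x
      proof -
        have "ennreal (q n x) \<le> ennreal (real n * indicator B x)"
          unfolding q_eq by (cases "x \<in> B") (auto simp: ennreal_of_nat_eq_real_of_nat)
        then show ?thesis by (cases "x \<in> B") (auto simp: q_def)
      qed
      have "\<rho> (\<lambda>x. ennreal (q n x)) \<le> \<rho> h"
        unfolding q_eq by (rule mono) (auto simp: indicator_def)
      then have "(\<integral>x. k x * q n x \<partial>M) \<le> c"
        using h by (intro bound[OF _ q_nn q_le]) auto
      moreover have "integrable M (\<lambda>x. k x * q n x)"
        by (rule integrable_mult_bd[OF _ _ k_bd, where L'="real n"]) (use q_nn q_le in auto)
      ultimately have "(\<integral>\<^sup>+x. ennreal (k x * q n x) \<partial>M) \<le> ennreal c"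
        using k_nn q_nn by (subst nn_integral_eq_integral) (auto intro: ennreal_leI)
      moreover have "ennreal (k x * q n x) = min (h x) (of_nat n) * ennreal (k x)" for x
        using k_nn[of x] q_nn[of x] k_off[of x]
        by (cases "x \<in> B") (auto simp: ennreal_mult q_eq mult.commute)
      ultimately show ?thesis by simp
    qed
    have SUP_min: "(SUP n. min (h x) (of_nat n)) = h x" for x
    proof -
      have "(SUP n. inf (h x) (of_nat n :: ennreal)) = inf (h x) (SUP n. of_nat n)"
        by (rule inf_SUP[symmetric])
      then show ?thesis by (simp add: ennreal_SUP_of_nat_eq_top inf_min)
    qed
    have "(\<integral>\<^sup>+x. h x * ennreal (k x) \<partial>M) = (\<integral>\<^sup>+x. (SUP n. min (h x) (of_nat n) * ennreal (k x)) \<partial>M)"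
      by (simp add: SUP_min flip: SUP_mult_right_ennreal)
    also have "\<dots> = (SUP n. \<integral>\<^sup>+x. min (h x) (of_nat n) * ennreal (k x) \<partial>M)"
      by (rule nn_integral_monotone_convergence_SUP)
         (auto simp: mono_def le_fun_def intro!: mult_right_mono min.mono)
    also have "\<dots> \<le> ennreal c" by (rule SUP_least) (rule qk)
    finally show ?thesis .
  qed
  have "0 < c"
  proof (rule ccontr)
    assume "\<not> 0 < c"
    then have "c = 0" using c0 by simp
    obtain b where b: "0 < b" "b < top" "\<rho> (\<lambda>x. b * indicator B x) \<le> 1"
      using small_multiple[OF _ ind] by auto
    then have "(\<integral>\<^sup>+x. b * indicator B x * ennreal (k x) \<partial>M) \<le> ennreal c"
      by (intro bound') auto
    then have "(\<integral>\<^sup>+x. b * indicator B x * ennreal (k x) \<partial>M) = 0"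
      using \<open>c = 0\<close> by simp
    then have "AE x in M. b * indicator B x * ennreal (k x) = 0"
      by (subst (asm) nn_integral_0_iff_AE) auto
    then have "AE x in M. k x * k x = 0"
      by eventually_elim (use b(1) k_nn k_off in \<open>auto simp: indicator_def ennreal_eq_0_iff split: if_splits intro: antisym\<close>)
    then have "(\<integral>x. k x * k x \<partial>M) = 0" by (subst integral_eq_zero_AE) auto
    then show False using kk_pos by simp
  qed
  define g where "g x = ennreal (k x / c)" for x
  have [measurable]: "g \<in> borel_measurable M" unfolding g_def by measurable
  have g_eq: "g x = ennreal (1 / c) * ennreal (k x)" for x
    using \<open>0 < c\<close> k_nn[of x] by (simp add: g_def flip: ennreal_mult)
  have int_g: "(\<integral>\<^sup>+x. h x * g x \<partial>M) = ennreal (1 / c) * (\<integral>\<^sup>+x. h x * ennreal (k x) \<partial>M)"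
    if [measurable]: "h \<in> borel_measurable M" for h
    by (subst nn_integral_cmult[symmetric]) (auto simp: g_eq mult_ac)
  have "(\<integral>\<^sup>+x. h x * g x \<partial>M) \<le> 1" if "h \<in> borel_measurable M" "\<rho> h \<le> 1" for h
  proof -
    have "(\<integral>\<^sup>+x. h x * g x \<partial>M) \<le> ennreal (1 / c) * ennreal c"
      unfolding int_g[OF that(1)] by (intro mult_left_mono bound' that) auto
    also have "\<dots> = 1" using \<open>0 < c\<close> by (simp flip: ennreal_mult)
    finally show ?thesis .
  qed
  moreover have "1 < (\<integral>\<^sup>+x. ennreal (\<phi> x) * g x \<partial>M)"
  proof -
    have \<phi>k: "\<phi> x * k x = k x * p x + k x * k x" for x by (simp add: k_def algebra_simps)
    have i\<phi>k: "integrable M (\<lambda>x. \<phi> x * k x)" unfolding \<phi>k using ikp ikk by simp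
    have "(\<integral>\<^sup>+x. ennreal (\<phi> x) * ennreal (k x) \<partial>M) = ennreal (\<integral>x. \<phi> x * k x \<partial>M)"
      using i\<phi>k \<phi>_nonneg k_nn
      by (simp flip: ennreal_mult add: nn_integral_eq_integral)
    also have "(\<integral>x. \<phi> x * k x \<partial>M) = c + (\<integral>x. k x * k x \<partial>M)"
      unfolding \<phi>k c_def using ikp ikk by simp
    finally have "(\<integral>\<^sup>+x. ennreal (\<phi> x) * g x \<partial>M) =
        ennreal (1 / c) * ennreal (c + (\<integral>x. k x * k x \<partial>M))"
      by (subst int_g) (auto simp only: measurable_compose[OF \<phi>_meas measurable_ennreal])
    also have "\<dots> = ennreal (1 / c * (c + (\<integral>x. k x * k x \<partial>M)))"
      using \<open>0 < c\<close> kk_pos by (intro ennreal_mult[symmetric]) auto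
    finally have "(\<integral>\<^sup>+x. ennreal (\<phi> x) * g x \<partial>M) = ennreal (1 / c * (c + (\<integral>x. k x * k x \<partial>M)))" .
    moreover have "1 < 1 / c * (c + (\<integral>x. k x * k x \<partial>M))"
      using \<open>0 < c\<close> kk_pos by (simp add: field_simps)
    ultimately show ?thesis by (simp add: ennreal_less_one_iff one_less_ennreal)
  qed
  ultimately show ?thesis by (intro bexI[of _ g]) auto
qed

end

lemma truncations_SUP:
  fixes B :: "nat \<Rightarrow> 'a set" and f :: "'a \<Rightarrow> ennreal"
  assumes B: "incseq B" "x \<in> (\<Union>n. B n)"
  shows "incseq (\<lambda>n. min (f x) (of_nat n) * indicator (B n) x)"
    and "(SUP n. min (f x) (of_nat n) * indicator (B n) x) = f x"
proof -
  show inc: "incseq (\<lambda>n. min (f x) (of_nat n) * indicator (B n) x)"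
  proof (rule monoI)
    fix m n :: nat assume "m \<le> n"
    then have "B m \<subseteq> B n" using B(1) by (auto simp: mono_def)
    then have "(indicator (B m) x :: ennreal) \<le> indicator (B n) x" by (auto simp: indicator_def)
    moreover have "min (f x) (of_nat m) \<le> min (f x) (of_nat n)"
      using \<open>m \<le> n\<close> by (intro min.mono) auto
    ultimately show "min (f x) (of_nat m) * indicator (B m) x \<le> min (f x) (of_nat n) * indicator (B n) x"
      by (intro mult_mono) auto
  qed
  obtain N where "x \<in> B N" using B(2) by blast
  then have "\<forall>\<^sub>F n in sequentially. min (f x) (of_nat n) = min (f x) (of_nat n) * indicator (B n) x"
    using monoD[OF B(1)] by (intro eventually_sequentiallyI[of N]) (simp add: subset_iff)
  moreover have "(\<lambda>n. min (f x) (of_nat n)) \<longlonglongrightarrow> min (f x) top"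
    by (intro tendsto_min tendsto_const of_nat_tendsto_top_ennreal)
  ultimately have "(\<lambda>n. min (f x) (of_nat n) * indicator (B n) x) \<longlonglongrightarrow> min (f x) top"
    by (rule Lim_transform_eventually[rotated])
  then show "(SUP n. min (f x) (of_nat n) * indicator (B n) x) = f x"
    using LIMSEQ_unique[OF LIMSEQ_SUP[OF inc]] by simp
qed

text \<open>By the Fatou property some truncation of \<open>f\<close> still has norm above one, and a function that
  separates the truncation separates \<open>f\<close>.\<close>

lemma (in fatou_norm) separation:
  fixes A :: "nat \<Rightarrow> 'a set"
  assumes A: "\<And>n. A n \<in> sets M" "(\<Union>n. A n) = space M" "\<And>n. emeasure M (A n) < top"
      "\<And>n. \<rho> (indicator (A n)) < top"
    and f [measurable]: "f \<in> borel_measurable M" and "1 < \<rho> f"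
  shows "\<exists>g\<in>borel_measurable M.
    (\<forall>h\<in>borel_measurable M. \<rho> h \<le> 1 \<longrightarrow> (\<integral>\<^sup>+x. h x * g x \<partial>M) \<le> 1) \<and> 1 < (\<integral>\<^sup>+x. f x * g x \<partial>M)"
proof -
  note [measurable] = A(1)
  define B where "B n = (\<Union>i\<le>n. A i)" for n
  have [measurable]: "B n \<in> sets M" for n unfolding B_def by measurable
  have B_inc: "incseq B" unfolding B_def by (intro monoI UN_mono) auto
  have B_cover: "(\<Union>n. B n) = space M" unfolding B_def A(2)[symmetric] by blast
  have B_fin: "emeasure M (B n) < top" for n
  proof -
    have "emeasure M (B n) \<le> (\<Sum>i\<le>n. emeasure M (A i))"
      unfolding B_def by (intro emeasure_subadditive_finite) (auto simp: A)
    also have "\<dots> < top" using A(3) by simp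
    finally show ?thesis .
  qed
  have B_rho: "\<rho> (indicator (B n)) < top" for n
  proof -
    have "\<rho> (indicator (B n)) \<le> \<rho> (\<lambda>x. \<Sum>i\<le>n. indicator (A i) x)"
    proof (rule mono)
      have "(indicator (B n) x :: ennreal) \<le> (\<Sum>i\<le>n. indicator (A i) x)" for x
      proof (cases "x \<in> B n")
        case True
        then obtain i where "i \<le> n" "x \<in> A i" by (auto simp: B_def)
        then show ?thesis
          using member_le_sum[of i "{..n}" "\<lambda>i. indicator (A i) x :: ennreal"] True by simp
      qed simp
      then show "AE x in M. (indicator (B n) x :: ennreal) \<le> (\<Sum>i\<le>n. indicator (A i) x)" by simp
    qed auto
    also have "\<dots> \<le> (\<Sum>i\<le>n. \<rho> (indicator (A i)))" by (rule sum_le) auto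
    also have "\<dots> < top" using A(4) by simp
    finally show ?thesis .
  qed
  define t where "t n x = min (f x) (of_nat n) * indicator (B n) x" for n x
  have [measurable]: "t n \<in> borel_measurable M" for n unfolding t_def by measurable
  have "\<rho> f = \<rho> (\<lambda>x. SUP n. t n x)"
    by (rule cong) (auto simp: t_def truncations_SUP(2)[OF B_inc] B_cover intro!: AE_I2)
  also have "\<dots> = (SUP n. \<rho> (t n))"
    by (rule monotone) (auto simp: t_def truncations_SUP(1)[OF B_inc] B_cover intro!: AE_I2)
  finally obtain n where n: "1 < \<rho> (t n)"
    using \<open>1 < \<rho> f\<close> by (auto simp: less_SUP_iff)
  have t_top: "t n x < top" for x
    unfolding t_def by (cases "x \<in> B n") (simp_all add: min_less_iff_disj of_nat_less_top)
  interpret bounded_truncation M \<rho> "\<lambda>x. enn2real (t n x)" "real n" "B n"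
  proof
    show "enn2real (t n x) \<le> real n * indicator (B n) x" for x
    proof -
      have "t n x \<le> ennreal (real n * indicator (B n) x)"
        by (cases "x \<in> B n") (auto simp: t_def ennreal_of_nat_eq_real_of_nat)
      then show ?thesis by (intro enn2real_leI) auto
    qed
  qed (auto simp: B_fin)
  have "1 < \<rho> (\<lambda>x. ennreal (enn2real (t n x)))" using n by (simp add: t_top)
  from separating_function[OF B_rho this]
  obtain g where g: "g \<in> borel_measurable M"
    "\<forall>h\<in>borel_measurable M. \<rho> h \<le> 1 \<longrightarrow> (\<integral>\<^sup>+x. h x * g x \<partial>M) \<le> 1"
    "1 < (\<integral>\<^sup>+x. t n x * g x \<partial>M)" by (auto simp: t_top)
  have "(\<integral>\<^sup>+x. t n x * g x \<partial>M) \<le> (\<integral>\<^sup>+x. f x * g x \<partial>M)"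
    by (intro nn_integral_mono mult_right_mono) (auto simp: t_def indicator_def)
  with g show ?thesis by (intro bexI[of _ g]) auto
qed

text \<open>Hoelder's inequality, by homogeneity; a function of norm zero vanishes a.e. and is treated
  apart since it cannot be normalised.\<close>

lemma (in function_norm) integral_le_norm:
  assumes [measurable]: "f \<in> borel_measurable M" "g \<in> borel_measurable M"
    and g: "pairing_norm M {h \<in> borel_measurable M. \<rho> h \<le> 1} g \<le> 1"
  shows "(\<integral>\<^sup>+x. f x * g x \<partial>M) \<le> \<rho> f"
proof -
  have le: "(\<integral>\<^sup>+x. h x * g x \<partial>M) \<le> 1" if "h \<in> borel_measurable M" "\<rho> h \<le> 1" for h
    using pairing_norm_upper[of h "{h \<in> borel_measurable M. \<rho> h \<le> 1}" M g] that g
    by (auto simp: mult.commute)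
  show ?thesis
  proof (cases "\<rho> f")
    case (real r)
    show ?thesis
    proof (cases "r = 0")
      case True
      then have "AE x in M. f x = 0" using real by (intro zero_imp) auto
      then have "(\<integral>\<^sup>+x. f x * g x \<partial>M) = 0"
        by (subst nn_integral_0_iff_AE) auto
      then show ?thesis by simp
    next
      case False
      have "\<rho> (\<lambda>x. ennreal (1/r) * f x) = ennreal (1/r) * ennreal r"
        by (subst scale) (auto simp: real)
      also have "\<dots> = 1" using real False by (simp flip: ennreal_mult)
      finally have "(\<integral>\<^sup>+x. ennreal (1/r) * f x * g x \<partial>M) \<le> 1" by (intro le) auto
      then have "ennreal (1/r) * (\<integral>\<^sup>+x. f x * g x \<partial>M) \<le> 1"
        by (simp add: mult.assoc nn_integral_cmult)
      then have "ennreal r * (ennreal (1/r) * (\<integral>\<^sup>+x. f x * g x \<partial>M)) \<le> ennreal r * 1"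
        by (rule mult_left_mono) simp
      then show ?thesis using real False by (simp flip: mult.assoc ennreal_mult)
    qed
  qed simp
qed

text \<open>The bipolar theorem for the unit ball: if the second associate norm of \<open>f\<close> were smaller than
  some \<open>r < \<rho> f\<close>, then \<open>f / r\<close> would lie outside the ball and could be separated from it.\<close>

theorem (in fatou_norm) lorentz_luxemburg:
  fixes A :: "nat \<Rightarrow> 'a set"
  assumes A: "\<And>n. A n \<in> sets M" "(\<Union>n. A n) = space M" "\<And>n. emeasure M (A n) < top"
      "\<And>n. \<rho> (indicator (A n)) < top"
    and f [measurable]: "f \<in> borel_measurable M"
  shows "pairing_norm M {g \<in> borel_measurable M.
           pairing_norm M {h \<in> borel_measurable M. \<rho> h \<le> 1} g \<le> 1} f = \<rho> f"
    (is "pairing_norm M ?B f = \<rho> f")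
proof (rule antisym)
  show "pairing_norm M ?B f \<le> \<rho> f"
    by (rule pairing_norm_leI) (auto intro: integral_le_norm)
  show "\<rho> f \<le> pairing_norm M ?B f"
  proof (rule ccontr)
    assume "\<not> ?thesis"
    then obtain c where c: "pairing_norm M ?B f < c" "c < \<rho> f" using dense by (auto simp: not_le)
    have "0 < c" by (rule le_less_trans[OF zero_le c(1)])
    then obtain r where r: "c = ennreal r" "0 < r"
      using c(2) by (cases c) (auto simp: top.extremum_strict)
    have "1 < \<rho> (\<lambda>x. ennreal (1/r) * f x)"
    proof -
      have "ennreal (1/r) * ennreal r < ennreal (1/r) * \<rho> f"
        using c(2) r by (intro ennreal_mult_strict_left_mono) auto
      then show ?thesis using r by (simp add: scale flip: ennreal_mult)
    qed
    from separation[OF A _ this]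
    obtain g where g [measurable]: "g \<in> borel_measurable M"
      and ball: "\<forall>h\<in>borel_measurable M. \<rho> h \<le> 1 \<longrightarrow> (\<integral>\<^sup>+x. h x * g x \<partial>M) \<le> 1"
      and gt: "1 < (\<integral>\<^sup>+x. ennreal (1/r) * f x * g x \<partial>M)" by auto
    have "g \<in> ?B"
      using ball by (auto intro!: pairing_norm_leI simp: mult.commute)
    then have "(\<integral>\<^sup>+x. f x * g x \<partial>M) \<le> c"
      using pairing_norm_upper[of g ?B M f] c(1) by (auto intro: order_trans less_imp_le)
    then have "ennreal (1/r) * (\<integral>\<^sup>+x. f x * g x \<partial>M) \<le> ennreal (1/r) * ennreal r"
      unfolding r(1) by (rule mult_left_mono) simp
    then have "(\<integral>\<^sup>+x. ennreal (1/r) * f x * g x \<partial>M) \<le> 1"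
      using r(2) by (simp add: mult.assoc nn_integral_cmult flip: ennreal_mult)
    with gt show False by simp
  qed
qed

section \<open>Core decreasing functions and their least majorants\<close>

lemma inverse_1_plus_le_iff: "inverse (1 + a) \<le> inverse (1 + b) \<longleftrightarrow> b \<le> a" for a b :: ennreal
proof -
  have real: "inverse (1 + ennreal r) = ennreal (inverse (1 + r))" if "0 \<le> r" for r
    using that by (subst inverse_ennreal[symmetric]) (auto simp: ennreal_plus)
  show ?thesis
    by (cases a; cases b) (auto simp: real top_unique ennreal_eq_0_iff field_simps)
qed

locale full_core = sigma_finite_measure M for M :: "'a measure" +
  fixes \<A> :: "'a set set"
  assumes full: "full_ordered_core M \<A>"
begin

lemma core_sets: "A \<in> \<A> \<Longrightarrow> A \<in> sets M"
  and core_finite: "A \<in> \<A> \<Longrightarrow> emeasure M A < top"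
  using full by (auto simp: full_ordered_core_def ordered_core_def)

lemma core_Pow: "\<A> \<subseteq> Pow (space M)"
  using core_sets sets.sets_into_space by blast

lemma core_cover:
  obtains A :: "nat \<Rightarrow> 'a set" where "\<And>n. A n \<in> \<A>" "(\<Union>n. A n) = space M"
proof -
  obtain \<A>0 where \<A>0: "\<A>0 \<subseteq> \<A>" "countable \<A>0" "\<Union>\<A> = \<Union>\<A>0"
    using full by (auto simp: full_ordered_core_def sigma_bounded_core_def)
  let ?B = "insert {} \<A>0"
  have "range (from_nat_into ?B) = ?B"
    using \<A>0(2) by (intro range_from_nat_into) auto
  moreover have "{} \<in> \<A>" "\<Union>\<A> = space M"
    using full by (auto simp: full_ordered_core_def ordered_core_def)
  ultimately have "from_nat_into ?B n \<in> \<A>" and "(\<Union>n. from_nat_into ?B n) = space M" for n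
    using \<A>0(1,3) by (auto simp: from_nat_into[of ?B n, simplified] subset_iff)
      (metis from_nat_into insert_iff insert_not_empty)
  then show ?thesis by (rule that)
qed

text \<open>A countable cover by core sets puts the whole space into the \<open>\<sigma>\<close>-ring, so closure under
  differences becomes closure under complements, and the measurable functions of the core are those
  of an ordinary measurable space.\<close>

lemma sigma_ring_sets_eq: "sigma_ring_sets \<A> = sigma_sets (space M) \<A>"
proof (intro set_eqI iffI)
  interpret S: sigma_algebra "space M" "sigma_sets (space M) \<A>"
    by (rule sigma_algebra_sigma_sets[OF core_Pow])
  show "A \<in> sigma_sets (space M) \<A>" if "A \<in> sigma_ring_sets \<A>" for A
    using that by induction auto
next
  obtain A :: "nat \<Rightarrow> 'a set" where A: "\<And>n. A n \<in> \<A>" "(\<Union>n. A n) = space M"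
    by (rule core_cover) blast
  have space: "space M \<in> sigma_ring_sets \<A>"
    unfolding A(2)[symmetric] by (intro sigma_ring_sets.Union sigma_ring_sets.Basic A)
  show "B \<in> sigma_ring_sets \<A>" if "B \<in> sigma_sets (space M) \<A>" for B
    using that by induction (auto intro: sigma_ring_sets.intros space)
qed

definition core_algebra :: "'a measure" where
  "core_algebra = sigma (space M) \<A>"

lemma space_core_algebra [simp]: "space core_algebra = space M"
  and sets_core_algebra: "sets core_algebra = sigma_sets (space M) \<A>"
  using core_Pow by (simp_all add: core_algebra_def)

lemma core_algebra_measurable: "f \<in> borel_measurable core_algebra \<Longrightarrow> f \<in> borel_measurable M"
proof -
  have "sets core_algebra \<subseteq> sets M"
    unfolding sets_core_algebra using core_sets by (intro sets.sigma_sets_subset) auto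
  then show "f \<in> borel_measurable core_algebra \<Longrightarrow> f \<in> borel_measurable M"
    by (auto simp: measurable_def)
qed

definition decreasing :: "('a \<Rightarrow> ennreal) set" where
  "decreasing = {f \<in> borel_measurable core_algebra.
     \<forall>u\<in>space M. \<forall>v\<in>space M. core_le \<A> u v \<longrightarrow> f v \<le> f u}"

lemma decreasing_measurable: "f \<in> decreasing \<Longrightarrow> f \<in> borel_measurable M"
  by (simp add: decreasing_def core_algebra_measurable)

lemma core_decreasing_iff:
  "f \<in> core_decreasing M \<A> \<longleftrightarrow> f \<in> borel_measurable core_algebra \<and> (\<forall>u\<in>space M. 0 \<le> f u) \<and>
     (\<forall>u\<in>space M. \<forall>v\<in>space M. core_le \<A> u v \<longrightarrow> f v \<le> f u)"
  by (simp add: core_decreasing_def measurable_def sets_core_algebra sigma_ring_sets_eq)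

lemma core_decreasing_measurable: "f \<in> core_decreasing M \<A> \<Longrightarrow> f \<in> borel_measurable M"
  by (simp add: core_decreasing_iff core_algebra_measurable)

lemma core_decreasing_nonneg: "f \<in> core_decreasing M \<A> \<Longrightarrow> x \<in> space M \<Longrightarrow> 0 \<le> f x"
  by (simp add: core_decreasing_iff)

lemma mag_decreasing: "f \<in> core_decreasing M \<A> \<Longrightarrow> mag f \<in> decreasing"
  by (auto simp: core_decreasing_iff decreasing_def mag_def intro!: e2ennreal_mono)

lemma enn2ereal_core_decreasing: "f \<in> decreasing \<Longrightarrow> (\<lambda>x. enn2ereal (f x)) \<in> core_decreasing M \<A>"
  by (auto simp: core_decreasing_iff decreasing_def less_eq_ennreal.rep_eq[symmetric])

lemma decreasing_const: "(\<lambda>x. c) \<in> decreasing"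
  by (simp add: decreasing_def)

lemma decreasing_indicator: "A \<in> \<A> \<Longrightarrow> indicator A \<in> decreasing"
  by (auto simp: decreasing_def core_le_def indicator_def sets_core_algebra
      intro!: borel_measurable_indicator)

lemma decreasing_scale: "f \<in> decreasing \<Longrightarrow> (\<lambda>x. c * f x) \<in> decreasing"
  by (auto simp: decreasing_def intro!: mult_left_mono)

lemma decreasing_min: "f \<in> decreasing \<Longrightarrow> g \<in> decreasing \<Longrightarrow> (\<lambda>x. min (f x) (g x)) \<in> decreasing"
  by (auto simp: decreasing_def simp: min_le_iff_disj)

lemma decreasing_add: "f \<in> decreasing \<Longrightarrow> g \<in> decreasing \<Longrightarrow> (\<lambda>x. f x + g x) \<in> decreasing"
  by (auto simp: decreasing_def intro!: add_mono)

text \<open>Any monotone operation on sequences that preserves measurability preserves core decreasing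
  functions; infima, suprema and series are the instances needed.\<close>

lemma decreasing_limitI:
  fixes F :: "nat \<Rightarrow> 'a \<Rightarrow> ennreal"
  assumes F: "\<And>n. F n \<in> decreasing" and L: "\<And>f g. (\<And>n. f n \<le> g n) \<Longrightarrow> L f \<le> L g"
    and meas: "(\<And>n. F n \<in> borel_measurable core_algebra) \<Longrightarrow>
      (\<lambda>x. L (\<lambda>n. F n x)) \<in> borel_measurable core_algebra"
  shows "(\<lambda>x. L (\<lambda>n. F n x)) \<in> decreasing"
  using F meas unfolding decreasing_def by (auto intro!: L)

lemma decreasing_INF: "(\<And>n::nat. F n \<in> decreasing) \<Longrightarrow> (\<lambda>x. INF n. F n x) \<in> decreasing"
  by (rule decreasing_limitI[where L="\<lambda>f. INF n. f n"]) (auto intro: INF_mono')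

lemma decreasing_SUP: "(\<And>n::nat. F n \<in> decreasing) \<Longrightarrow> (\<lambda>x. SUP n. F n x) \<in> decreasing"
  by (rule decreasing_limitI[where L="\<lambda>f. SUP n. f n"]) (auto intro: SUP_mono')

lemma decreasing_suminf: "(\<And>n. F n \<in> decreasing) \<Longrightarrow> (\<lambda>x. \<Sum>n. F n x) \<in> decreasing"
  by (rule decreasing_limitI[where L=suminf]) (auto intro: suminf_le)

text \<open>Among the core decreasing majorants \<open>h\<close> of \<open>f\<close>, maximise \<open>\<integral> w / (1 + h)\<close> for a strictly positive
  integrable weight \<open>w\<close>.  Majorants are closed under countable infima, so the maximum is attained
  by some \<open>t\<close>.  For any other majorant \<open>g\<close> the minimum of \<open>t\<close> and \<open>g\<close> is again a majorant, hence
  cannot have a larger integral, and must agree with \<open>t\<close> a.e.\<close>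

lemma least_majorant_exists:
  assumes [measurable]: "f \<in> borel_measurable M"
  shows "\<exists>t\<in>decreasing. (AE x in M. f x \<le> t x) \<and>
    (\<forall>h\<in>decreasing. (AE x in M. f x \<le> h x) \<longrightarrow> (AE x in M. t x \<le> h x))"
proof -
  obtain w :: "'a \<Rightarrow> ennreal" where w [measurable]: "w \<in> borel_measurable M"
    and w_fin: "(\<integral>\<^sup>+x. w x \<partial>M) \<noteq> \<infinity>" and w_pos: "\<And>x. x \<in> space M \<Longrightarrow> 0 < w x \<and> w x < \<infinity>"
    using Ex_finite_integrable_function by blast
  define H where "H = {h \<in> decreasing. AE x in M. f x \<le> h x}"
  define \<Phi> where "\<Phi> h = (\<integral>\<^sup>+x. inverse (1 + h x) * w x \<partial>M)" for h :: "'a \<Rightarrow> ennreal"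
  have Hm: "h \<in> borel_measurable M" if "h \<in> H" for h
    using that by (simp add: H_def decreasing_measurable)

  have \<Phi>_mono: "\<Phi> h \<le> \<Phi> g" if "AE x in M. g x \<le> h x" for g h
    unfolding \<Phi>_def
    by (intro nn_integral_mono_AE eventually_mono[OF that] mult_right_mono)
       (auto simp: inverse_1_plus_le_iff)
  have "(\<lambda>x. top) \<in> H" by (simp add: H_def decreasing_const)
  then have ne: "H \<noteq> {}" by blast
  obtain \<phi> :: "nat \<Rightarrow> ennreal" where \<phi>: "range \<phi> \<subseteq> \<Phi> ` H" "Sup (\<Phi> ` H) = Sup (range \<phi>)"
    using ennreal_SUP_countable_SUP[OF ne, of \<Phi>] by blast
  then have "\<forall>n. \<exists>h. h \<in> H \<and> \<phi> n = \<Phi> h" by blast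
  from choice[OF this] obtain h where h: "\<And>n. h n \<in> H" "\<And>n. \<phi> n = \<Phi> (h n)" by blast
  define t where "t x = (INF n. h n x)" for x
  have t_dec: "t \<in> decreasing"
    unfolding t_def[abs_def] using h(1) by (intro decreasing_INF) (simp add: H_def)
  have "AE x in M. \<forall>n. f x \<le> h n x"
    unfolding AE_all_countable using h(1) by (simp add: H_def)
  then have t_maj: "AE x in M. f x \<le> t x"
    by eventually_elim (simp add: t_def INF_greatest)
  have t_max: "\<Phi> g \<le> \<Phi> t" if "g \<in> H" for g
  proof -
    have "\<Phi> g \<le> Sup (range \<phi>)" unfolding \<phi>(2)[symmetric] using that by (rule SUP_upper)
    also have "\<dots> \<le> \<Phi> t"
      unfolding h(2) by (intro SUP_least \<Phi>_mono AE_I2) (auto simp: t_def intro: INF_lower)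
    finally show ?thesis .
  qed
  have "AE x in M. t x \<le> g x" if g: "g \<in> decreasing" and g_maj: "AE x in M. f x \<le> g x" for g
  proof -
    define m where "m x = min (t x) (g x)" for x
    have m_dec: "m \<in> decreasing" unfolding m_def[abs_def] by (rule decreasing_min[OF t_dec g])
    moreover have "AE x in M. f x \<le> m x"
      using t_maj g_maj by eventually_elim (simp add: m_def)
    ultimately have "\<Phi> m \<le> \<Phi> t" by (intro t_max) (simp add: H_def)
    have [measurable]: "t \<in> borel_measurable M" "m \<in> borel_measurable M"
      using t_dec m_dec by (auto intro: decreasing_measurable)
    let ?a = "\<lambda>x. inverse (1 + t x) * w x" and ?b = "\<lambda>x. inverse (1 + m x) * w x"
    have "\<Phi> t \<le> (\<integral>\<^sup>+x. inverse (1 + 0) * w x \<partial>M)"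
      unfolding \<Phi>_def by (intro nn_integral_mono mult_right_mono) (simp_all only: inverse_1_plus_le_iff zero_le)
    then have fin: "\<Phi> t \<noteq> \<infinity>" using w_fin by (auto simp: top_unique)
    have "(\<integral>\<^sup>+x. ?b x - ?a x \<partial>M) = \<Phi> m - \<Phi> t"
      unfolding \<Phi>_def
    proof (rule nn_integral_diff)
      show "AE x in M. ?a x \<le> ?b x"
        by (intro AE_I2 mult_right_mono) (auto simp: inverse_1_plus_le_iff m_def)
    qed (use fin in \<open>auto simp: \<Phi>_def\<close>)
    also have "\<dots> = 0" using \<open>\<Phi> m \<le> \<Phi> t\<close> fin by (simp add: diff_eq_0_iff_ennreal less_top)
    finally have "AE x in M. ?b x - ?a x = 0"
      by (subst (asm) nn_integral_0_iff_AE) auto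
    then show ?thesis
      using AE_space
    proof eventually_elim
      case (elim x)
      then have "w x * inverse (1 + m x) \<le> w x * inverse (1 + t x)"
        by (auto simp: diff_eq_0_iff_ennreal mult.commute)
      then have "inverse (1 + m x) \<le> inverse (1 + t x)"
        using w_pos[OF elim(2)] by (subst (asm) ennreal_mult_le_mult_iff) auto
      then show ?case by (simp add: inverse_1_plus_le_iff m_def)
    qed
  qed
  with t_dec t_maj show ?thesis by blast
qed

lemma is_least_core_majorant_core_majorant:
  assumes [measurable]: "g \<in> borel_measurable M"
  shows "is_least_core_majorant M \<A> g (core_majorant M \<A> g)"
proof -
  obtain t where t: "t \<in> decreasing" "AE x in M. mag g x \<le> t x"
    "\<And>h. h \<in> decreasing \<Longrightarrow> AE x in M. mag g x \<le> h x \<Longrightarrow> AE x in M. t x \<le> h x"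
    using least_majorant_exists[of "mag g"] by auto
  have "is_least_core_majorant M \<A> g (\<lambda>x. enn2ereal (t x))"
    unfolding is_least_core_majorant_def
  proof (intro conjI ballI impI)
    show "(\<lambda>x. enn2ereal (t x)) \<in> core_decreasing M \<A>"
      by (rule enn2ereal_core_decreasing[OF t(1)])
    show "AE x in M. \<bar>g x\<bar> \<le> enn2ereal (t x)"
      using t(2) by (simp add: mag_def less_eq_ennreal.rep_eq enn2ereal_e2ennreal)
    fix h assume h: "h \<in> core_decreasing M \<A>" and le: "AE x in M. \<bar>g x\<bar> \<le> h x"
    have "AE x in M. mag g x \<le> mag h x"
      unfolding AE_mag_le_iff using le by eventually_elim (metis abs_ereal_ge0 abs_ereal_pos order_trans)
    then have "AE x in M. t x \<le> mag h x" by (rule t(3)[OF mag_decreasing[OF h]])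
    with AE_space show "AE x in M. enn2ereal (t x) \<le> h x"
      by eventually_elim
        (use core_decreasing_nonneg[OF h] in \<open>auto simp: mag_def less_eq_ennreal.rep_eq enn2ereal_e2ennreal\<close>)
  qed
  then show ?thesis unfolding core_majorant_def
    by (rule someI[of "is_least_core_majorant M \<A> g"])
qed

text \<open>Least majorants depend only on absolute values, so they are studied as an operator on
  nonnegative functions.\<close>

definition majorant :: "('a \<Rightarrow> ennreal) \<Rightarrow> 'a \<Rightarrow> ennreal" where
  "majorant f = mag (core_majorant M \<A> (\<lambda>x. enn2ereal (f x)))"

lemma core_majorant_mag: "core_majorant M \<A> (\<lambda>x. enn2ereal (mag g x)) = core_majorant M \<A> g"
  by (simp add: core_majorant_def is_least_core_majorant_def mag_def enn2ereal_e2ennreal)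

lemma mag_core_majorant: "mag (core_majorant M \<A> g) = majorant (mag g)"
  by (simp add: majorant_def core_majorant_mag)

lemma core_majorant_decreasing:
  "g \<in> borel_measurable M \<Longrightarrow> core_majorant M \<A> g \<in> core_decreasing M \<A>"
  using is_least_core_majorant_core_majorant by (auto simp: is_least_core_majorant_def)

lemma core_majorant_eq:
  assumes "g \<in> borel_measurable M" "x \<in> space M"
  shows "core_majorant M \<A> g x = enn2ereal (majorant (mag g) x)"
  using core_decreasing_nonneg[OF core_majorant_decreasing[OF assms(1)] assms(2)]
  unfolding mag_core_majorant[symmetric] by (simp add: mag_def enn2ereal_e2ennreal)

lemma majorant_decreasing: "f \<in> borel_measurable M \<Longrightarrow> majorant f \<in> decreasing"
  unfolding majorant_def by (intro mag_decreasing core_majorant_decreasing) measurable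

lemma majorant_measurable [measurable (raw)]:
  "f \<in> borel_measurable M \<Longrightarrow> majorant f \<in> borel_measurable M"
  by (rule decreasing_measurable[OF majorant_decreasing])

lemma le_majorant:
  assumes "f \<in> borel_measurable M"
  shows "AE x in M. f x \<le> majorant f x"
proof -
  have "(\<lambda>x. enn2ereal (f x)) \<in> borel_measurable M" using assms by measurable
  from is_least_core_majorant_core_majorant[OF this]
  have "AE x in M. enn2ereal (f x) \<le> core_majorant M \<A> (\<lambda>x. enn2ereal (f x)) x"
    by (simp add: is_least_core_majorant_def)
  then show ?thesis
  proof eventually_elim
    case (elim x)
    have "a \<le> \<bar>a\<bar>" for a :: ereal by (cases a) auto
    with elim have "enn2ereal (f x) \<le> \<bar>core_majorant M \<A> (\<lambda>x. enn2ereal (f x)) x\<bar>"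
      by (rule order_trans)
    from e2ennreal_mono[OF this] show ?case
      by (simp add: majorant_def mag_def)
  qed
qed

lemma majorant_least:
  assumes f: "f \<in> borel_measurable M" and h: "h \<in> decreasing" and le: "AE x in M. f x \<le> h x"
  shows "AE x in M. majorant f x \<le> h x"
proof -
  have fm: "(\<lambda>x. enn2ereal (f x)) \<in> borel_measurable M" using f by measurable
  have "AE x in M. \<bar>enn2ereal (f x)\<bar> \<le> enn2ereal (h x)"
    using le by (simp add: less_eq_ennreal.rep_eq)
  then have "AE x in M. core_majorant M \<A> (\<lambda>x. enn2ereal (f x)) x \<le> enn2ereal (h x)"
    using is_least_core_majorant_core_majorant[OF fm, unfolded is_least_core_majorant_def,
        THEN conjunct2, THEN conjunct2, rule_format, OF enn2ereal_core_decreasing[OF h]] by simp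
  then show ?thesis
    using AE_space
  proof eventually_elim
    case (elim x)
    then show ?case
      by (simp add: core_majorant_eq[OF fm] less_eq_ennreal.rep_eq)
  qed
qed

lemma majorant_of_decreasing:
  assumes "h \<in> decreasing"
  shows "AE x in M. majorant h x = h x"
proof -
  have "AE x in M. h x \<le> majorant h x" by (intro le_majorant decreasing_measurable assms)
  moreover have "AE x in M. majorant h x \<le> h x"
    by (intro majorant_least decreasing_measurable assms) auto
  ultimately show ?thesis by eventually_elim (rule antisym)
qed

lemma majorant_mono:
  assumes "f \<in> borel_measurable M" "g \<in> borel_measurable M" "AE x in M. f x \<le> g x"
  shows "AE x in M. majorant f x \<le> majorant g x"
proof (rule majorant_least[OF assms(1) majorant_decreasing[OF assms(2)]])
  show "AE x in M. f x \<le> majorant g x"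
    using assms(3) le_majorant[OF assms(2)] by eventually_elim (rule order_trans)
qed

lemma majorant_add:
  assumes [measurable]: "f \<in> borel_measurable M" "g \<in> borel_measurable M"
  shows "AE x in M. majorant (\<lambda>x. f x + g x) x \<le> majorant f x + majorant g x"
proof (rule majorant_least)
  show "AE x in M. f x + g x \<le> majorant f x + majorant g x"
    using le_majorant[OF assms(1)] le_majorant[OF assms(2)] by eventually_elim (rule add_mono)
qed (auto intro: decreasing_add majorant_decreasing assms)

lemma majorant_suminf:
  assumes [measurable]: "\<And>n. F n \<in> borel_measurable M"
  shows "AE x in M. majorant (\<lambda>x. \<Sum>n. F n x) x \<le> (\<Sum>n. majorant (F n) x)"
proof (rule majorant_least)
  have "AE x in M. \<forall>n. F n x \<le> majorant (F n) x"
    unfolding AE_all_countable by (intro allI le_majorant assms)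
  then show "AE x in M. (\<Sum>n. F n x) \<le> (\<Sum>n. majorant (F n) x)"
    by eventually_elim (auto intro: suminf_le)
qed (measurable, intro decreasing_suminf majorant_decreasing assms)

lemma majorant_SUP:
  fixes F :: "nat \<Rightarrow> 'a \<Rightarrow> ennreal"
  assumes [measurable]: "\<And>n. F n \<in> borel_measurable M"
  shows "AE x in M. majorant (\<lambda>x. SUP n. F n x) x = (SUP n. majorant (F n) x)"
proof -
  have "AE x in M. majorant (\<lambda>x. SUP n. F n x) x \<le> (SUP n. majorant (F n) x)"
  proof (rule majorant_least)
    have "AE x in M. \<forall>n. F n x \<le> majorant (F n) x"
      unfolding AE_all_countable by (intro allI le_majorant assms)
    then show "AE x in M. (SUP n. F n x) \<le> (SUP n. majorant (F n) x)"
      by eventually_elim (auto intro: SUP_mono')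
  qed (measurable, intro decreasing_SUP majorant_decreasing assms)
  moreover have "AE x in M. \<forall>n. majorant (F n) x \<le> majorant (\<lambda>x. SUP n. F n x) x"
    unfolding AE_all_countable by (intro allI majorant_mono) (auto intro!: AE_I2 SUP_upper)
  ultimately show ?thesis
    by eventually_elim (auto intro!: antisym SUP_least)
qed

lemma majorant_scale_le:
  assumes [measurable]: "f \<in> borel_measurable M"
  shows "AE x in M. majorant (\<lambda>x. c * f x) x \<le> c * majorant f x"
proof (rule majorant_least)
  show "AE x in M. c * f x \<le> c * majorant f x"
    using le_majorant[OF assms] by eventually_elim (rule mult_left_mono, auto)
qed (auto intro: decreasing_scale majorant_decreasing assms)

lemma majorant_scale:
  assumes [measurable]: "f \<in> borel_measurable M" and c: "c < top"
  shows "AE x in M. majorant (\<lambda>x. c * f x) x = c * majorant f x"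
proof (cases "c = 0")
  case True
  then show ?thesis using majorant_scale_le[OF assms(1), of c] by simp
next
  case False
  have inv: "inverse c * c = 1" using False c by (simp add: ennreal_divide_self flip: divide_ennreal_def add: mult.commute)
  have "AE x in M. majorant (\<lambda>x. inverse c * (c * f x)) x \<le> inverse c * majorant (\<lambda>x. c * f x) x"
    by (rule majorant_scale_le) measurable
  then have "AE x in M. majorant f x \<le> inverse c * majorant (\<lambda>x. c * f x) x"
    by (simp add: inv flip: mult.assoc)
  with majorant_scale_le[OF assms(1), of c] show ?thesis
  proof eventually_elim
    case (elim x)
    have "c * majorant f x \<le> c * (inverse c * majorant (\<lambda>x. c * f x) x)"
      using elim(2) by (rule mult_left_mono) simp
    also have "\<dots> = majorant (\<lambda>x. c * f x) x"
      using inv by (simp add: mult.commute[of c] flip: mult.assoc)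
    finally show ?case using elim(1) by (rule antisym[rotated])
  qed
qed

lemma sublinear_core_majorant: "sublinear_ae M (core_majorant M \<A>)"
  unfolding sublinear_ae_def
proof (intro conjI ballI allI impI)
  fix f :: "'a \<Rightarrow> ereal" and c :: real
  assume [measurable]: "f \<in> borel_measurable M" and c: "0 \<le> c"
  have "AE x in M. majorant (\<lambda>x. ennreal c * mag f x) x = ennreal c * majorant (mag f) x"
    by (rule majorant_scale) auto
  with AE_space show "AE x in M. core_majorant M \<A> (\<lambda>x. ereal c * f x) x = ereal c * core_majorant M \<A> f x"
  proof eventually_elim
    case (elim x)
    then show ?case
      using c by (simp add: core_majorant_eq mag_scale times_ennreal.rep_eq enn2ereal_ennreal)
  qed
next
  fix f g :: "'a \<Rightarrow> ereal"
  assume [measurable]: "f \<in> borel_measurable M" "g \<in> borel_measurable M"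
  have "AE x in M. majorant (mag (\<lambda>x. f x + g x)) x \<le> majorant (\<lambda>x. mag f x + mag g x) x"
    by (rule majorant_mono) (auto simp: mag_def e2ennreal_abs_add_le)
  moreover have "AE x in M. majorant (\<lambda>x. mag f x + mag g x) x \<le> majorant (mag f) x + majorant (mag g) x"
    by (rule majorant_add) auto
  ultimately show "AE x in M. core_majorant M \<A> (\<lambda>x. f x + g x) x \<le> core_majorant M \<A> f x + core_majorant M \<A> g x"
    using AE_space
  proof eventually_elim
    case (elim x)
    have "enn2ereal (majorant (mag (\<lambda>x. f x + g x)) x) \<le> enn2ereal (majorant (mag f) x + majorant (mag g) x)"
      using order_trans[OF elim(1,2)] by (simp add: less_eq_ennreal.rep_eq)
    then show ?case
      using elim(3) by (simp add: core_majorant_eq plus_ennreal.rep_eq)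
  qed
qed

section \<open>Norms of majorants, the tilde space and the down space\<close>

lemma function_norm_majorant:
  assumes "function_norm M \<rho>"
  shows "function_norm M (\<lambda>f. \<rho> (majorant f))"
proof -
  interpret N: function_norm M \<rho> by fact
  show ?thesis
  proof
    show "\<rho> (majorant f) \<le> \<rho> (majorant g)"
      if "f \<in> borel_measurable M" "g \<in> borel_measurable M" "AE x in M. f x \<le> g x" for f g
      using that by (intro N.mono majorant_mono majorant_measurable)
    show "\<rho> (majorant (\<lambda>x. c * f x)) = c * \<rho> (majorant f)"
      if [measurable]: "f \<in> borel_measurable M" and c: "c < top" for f c
    proof -
      have "\<rho> (majorant (\<lambda>x. c * f x)) = \<rho> (\<lambda>x. c * majorant f x)"
        using majorant_scale[OF that] by (intro N.cong) auto
      then show ?thesis using c by (simp add: N.scale)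
    qed
    show "\<rho> (majorant (\<lambda>x. \<Sum>n. F n x)) \<le> (\<Sum>n. \<rho> (majorant (F n)))"
      if [measurable]: "\<And>n. F n \<in> borel_measurable M" for F
    proof -
      have "\<rho> (majorant (\<lambda>x. \<Sum>n. F n x)) \<le> \<rho> (\<lambda>x. \<Sum>n. majorant (F n) x)"
        using majorant_suminf[OF that] by (intro N.mono) auto
      also have "\<dots> \<le> (\<Sum>n. \<rho> (majorant (F n)))" by (rule N.series) auto
      finally show ?thesis .
    qed
    show "AE x in M. f x = 0" if "f \<in> borel_measurable M" "\<rho> (majorant f) = 0" for f
    proof -
      have "AE x in M. majorant f x = 0"
        using that by (intro N.zero_imp majorant_measurable)
      with le_majorant[OF that(1)] show ?thesis by eventually_elim auto
    qed
    show "AE x in M. f x < top" if "f \<in> borel_measurable M" "\<rho> (majorant f) < top" for f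
    proof -
      have "AE x in M. majorant f x < top"
        using that by (intro N.finite_imp majorant_measurable)
      with le_majorant[OF that(1)] show ?thesis by eventually_elim (rule le_less_trans)
    qed
  qed
qed

lemma fatou_norm_majorant:
  assumes "fatou_norm M \<rho>"
  shows "fatou_norm M (\<lambda>f. \<rho> (majorant f))"
proof -
  interpret N: fatou_norm M \<rho> by fact
  interpret function_norm M "\<lambda>f. \<rho> (majorant f)"
    by (rule function_norm_majorant) (rule N.function_norm_axioms)
  show ?thesis
  proof
    fix F :: "nat \<Rightarrow> 'a \<Rightarrow> ennreal"
    assume F [measurable]: "\<And>n. F n \<in> borel_measurable M" and inc: "AE x in M. incseq (\<lambda>n. F n x)"
    have "\<rho> (majorant (\<lambda>x. SUP n. F n x)) = \<rho> (\<lambda>x. SUP n. majorant (F n) x)"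
      using majorant_SUP[OF F] by (intro N.cong) auto
    also have "\<dots> = (SUP n. \<rho> (majorant (F n)))"
    proof (rule N.monotone)
      have "AE x in M. \<forall>n. majorant (F n) x \<le> majorant (F (Suc n)) x"
        unfolding AE_all_countable
        by (intro allI majorant_mono F eventually_mono[OF inc]) (rule incseq_SucD)
      then show "AE x in M. incseq (\<lambda>n. majorant (F n) x)"
        by eventually_elim (simp add: incseq_Suc_iff)
    qed auto
    finally show "\<rho> (majorant (\<lambda>x. SUP n. F n x)) = (SUP n. \<rho> (majorant (F n)))" .
  qed
qed

text \<open>Only the behaviour of \<open>X\<close> on core decreasing functions enters, and these are nonnegative; so
  the lemma also covers \<open>X\<close> with \<open>\<rho> = bfs_norm X\<close>, where \<open>normed_by M X \<rho>\<close> may fail.\<close>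

lemma normed_by_tilde_space:
  assumes "\<And>h. h \<in> core_decreasing M \<A> \<Longrightarrow> (h \<in> elems X \<longleftrightarrow> \<rho> (mag h) < top) \<and>
      (h \<in> elems X \<longrightarrow> fnorm X h = enn2real (\<rho> (mag h)))"
  shows "normed_by M (tilde_space M \<A> X) (\<lambda>f. \<rho> (majorant f))"
  using assms[OF core_majorant_decreasing]
  by (auto simp: normed_by_def tilde_space_def mag_core_majorant)

definition down :: "(('a \<Rightarrow> ennreal) \<Rightarrow> ennreal) \<Rightarrow> ('a \<Rightarrow> ennreal) \<Rightarrow> ennreal" where
  "down \<rho> = pairing_norm M {g \<in> decreasing. \<rho> g \<le> 1}"

lemma normed_by_down_space:
  assumes Y: "normed_by M (associate M X) \<rho>"
  shows "normed_by M (down_space M \<A> X) (down \<rho>)"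
proof -
  let ?C = "{g \<in> elems (associate M X) \<inter> core_decreasing M \<A>. fnorm (associate M X) g \<le> 1}"
  have int: "(\<integral>\<^sup>+x. e2ennreal (\<bar>f x\<bar> * g x) \<partial>M) = (\<integral>\<^sup>+x. mag f x * mag g x \<partial>M)"
    if "g \<in> core_decreasing M \<A>" for f g
  proof (rule nn_integral_cong)
    fix x assume "x \<in> space M"
    then have "0 \<le> g x" by (rule core_decreasing_nonneg[OF that])
    then show "e2ennreal (\<bar>f x\<bar> * g x) = mag f x * mag g x"
      using e2ennreal_abs_mult[of "\<bar>f x\<bar>" "g x"] by (simp add: mag_def)
  qed
  have C: "mag ` ?C = {g \<in> decreasing. \<rho> g \<le> 1}"
  proof (intro set_eqI iffI)
    fix g assume "g \<in> mag ` ?C"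
    then obtain h where h: "h \<in> ?C" "g = mag h" by blast
    then show "g \<in> {g \<in> decreasing. \<rho> g \<le> 1}"
      using normed_by_norm_le[OF Y, of h 1] by (auto simp: mag_decreasing)
  next
    fix g assume g: "g \<in> {g \<in> decreasing. \<rho> g \<le> 1}"
    let ?h = "\<lambda>x. enn2ereal (g x)"
    have [measurable]: "g \<in> borel_measurable M" using g by (simp add: decreasing_measurable)
    have "?h \<in> elems (associate M X)"
      using g by (auto simp: normed_by_mem[OF Y] intro: le_less_trans)
    with g normed_by_norm_le[OF Y this, of 1] have "?h \<in> ?C"
      by (auto simp: enn2ereal_core_decreasing)
    then show "g \<in> mag ` ?C" by (rule image_eqI[rotated]) simp
  qed
  have "down_norm M \<A> X f = down \<rho> (mag f)" for f
    unfolding down_norm_def down_def pairing_norm_def C[symmetric] image_image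
    by (rule SUP_cong) (auto simp: int)
  then have "down_norm M \<A> X = (\<lambda>f. down \<rho> (mag f))" by blast
  then show ?thesis
    unfolding down_space_def by (simp add: normed_by_finite_part)
qed

text \<open>A core decreasing \<open>g\<close> is its own majorant, and replacing a test function by its majorant
  increases the integral; so both sets of test functions give the same supremum.\<close>

lemma down_eq_pairing_norm:
  assumes "function_norm M \<rho>" and [measurable]: "f \<in> borel_measurable M"
  shows "down \<rho> f = pairing_norm M {h \<in> borel_measurable M. \<rho> (majorant h) \<le> 1} f"
proof (rule antisym)
  interpret N: function_norm M \<rho> by fact
  show "down \<rho> f \<le> pairing_norm M {h \<in> borel_measurable M. \<rho> (majorant h) \<le> 1} f"
    unfolding down_def
  proof (rule pairing_norm_leI)
    fix g assume g: "g \<in> {g \<in> decreasing. \<rho> g \<le> 1}"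
    then have [measurable]: "g \<in> borel_measurable M" by (simp add: decreasing_measurable)
    have "\<rho> (majorant g) = \<rho> g"
      using majorant_of_decreasing[of g] g by (intro N.cong) auto
    with g show "(\<integral>\<^sup>+x. f x * g x \<partial>M) \<le> pairing_norm M {h \<in> borel_measurable M. \<rho> (majorant h) \<le> 1} f"
      by (intro pairing_norm_upper) auto
  qed
  show "pairing_norm M {h \<in> borel_measurable M. \<rho> (majorant h) \<le> 1} f \<le> down \<rho> f"
  proof (rule pairing_norm_leI)
    fix h assume h: "h \<in> {h \<in> borel_measurable M. \<rho> (majorant h) \<le> 1}"
    then have "(\<integral>\<^sup>+x. f x * h x \<partial>M) \<le> (\<integral>\<^sup>+x. f x * majorant h x \<partial>M)"
      by (intro nn_integral_mono_AE eventually_mono[OF le_majorant[of h]] mult_left_mono) auto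
    also have "\<dots> \<le> down \<rho> f"
      unfolding down_def using h by (intro pairing_norm_upper) (auto intro: majorant_decreasing)
    finally show "(\<integral>\<^sup>+x. f x * h x \<partial>M) \<le> down \<rho> f" .
  qed
qed

text \<open>Constants are core decreasing, so the essential supremum bounds the majorant as well.\<close>

lemma esssup_majorant:
  assumes [measurable]: "f \<in> borel_measurable M"
  shows "esssup M (majorant f) = esssup M f"
proof (rule antisym)
  have "AE x in M. majorant f x \<le> esssup M f"
    using esssup_AE[of f M] by (intro majorant_least decreasing_const) auto
  then show "esssup M (majorant f) \<le> esssup M f" by (intro esssup_I) auto
  show "esssup M f \<le> esssup M (majorant f)"
    using le_majorant[OF assms] by (intro esssup_AE_mono) auto
qed

lemma tilde_space_Linfty: "same_space (tilde_space M \<A> (Linfty M)) (Linfty M)"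
proof -
  have L: "normed_by M (Linfty M) (esssup M)"
    using normed_by_finite_part[of M "esssup M"] by (simp add: Linfty_def mag_def)
  have "normed_by M (tilde_space M \<A> (Linfty M)) (\<lambda>f. esssup M (majorant f))"
    using L by (intro normed_by_tilde_space) (auto simp: normed_by_def core_decreasing_measurable)
  from normed_by_same_space[OF this L] show ?thesis by (simp add: esssup_majorant)
qed

end

text \<open>In the supremum that defines the level function, the test function \<open>g\<close> itself is admissible.\<close>

lemma (in full_core) level_function_bound:
  assumes fo: "is_level_function M \<A> f fo" and g: "g \<in> decreasing"
  shows "(\<integral>\<^sup>+x. mag f x * g x \<partial>M) \<le> (\<integral>\<^sup>+x. mag fo x * g x \<partial>M)"
proof -
  let ?g = "\<lambda>x. enn2ereal (g x)"
  have g_core: "?g \<in> core_decreasing M \<A>" by (rule enn2ereal_core_decreasing[OF g])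
  have fo_dec: "fo \<in> core_decreasing M \<A>" using fo by (simp add: is_level_function_def)
  have mult: "e2ennreal (\<bar>a\<bar> * enn2ereal b) = e2ennreal \<bar>a\<bar> * b" for a b
    using e2ennreal_abs_mult[of "\<bar>a\<bar>" "enn2ereal b"] by simp
  have "(\<integral>\<^sup>+x. mag f x * g x \<partial>M) = (\<integral>\<^sup>+x. e2ennreal (\<bar>f x\<bar> * ?g x) \<partial>M)"
    by (simp add: mult mag_def)
  also have "\<dots> \<le> (SUP h\<in>{h \<in> core_decreasing M \<A>.
                  \<forall>A\<in>\<A>. (\<integral>\<^sup>+x\<in>A. e2ennreal (h x) \<partial>M) \<le> (\<integral>\<^sup>+x\<in>A. e2ennreal (?g x) \<partial>M)}.
           \<integral>\<^sup>+x. e2ennreal (\<bar>f x\<bar> * h x) \<partial>M)"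
    using g_core by (intro SUP_upper) auto
  also have "\<dots> = (\<integral>\<^sup>+x. e2ennreal (fo x * ?g x) \<partial>M)"
    by (rule fo[unfolded is_level_function_def, THEN conjunct2, THEN bspec, OF g_core, symmetric])
  also have "\<dots> = (\<integral>\<^sup>+x. mag fo x * g x \<partial>M)"
  proof (rule nn_integral_cong)
    fix x assume "x \<in> space M"
    then have "fo x = \<bar>fo x\<bar>" using core_decreasing_nonneg[OF fo_dec] by simp
    then show "e2ennreal (fo x * ?g x) = mag fo x * g x"
      using mult[of "fo x" "g x"] by (simp add: mag_def)
  qed
  finally show ?thesis .
qed

section \<open>Duality of down spaces and tilde spaces\<close>

theorem theorem7p7:
  fixes M :: "'a measure" and \<A> :: "'a set set" and X :: "'a fun_space"
  assumes "sigma_finite_measure M"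
    and "full_ordered_core M \<A>"
    and "banach_function_space M X"
    and "\<forall>E\<in>sets M. emeasure M E < \<infinity> \<longrightarrow>
           indicator E \<in> elems X \<and> indicator E \<in> elems (associate M X)"
  shows "banach_function_space M (down_space M \<A> X) \<and> fatou_property M (down_space M \<A> X) \<and>
    (\<forall>f\<in>elems (associate M (associate M X)).
       f \<in> elems (down_space M \<A> X) \<and>
       fnorm (down_space M \<A> X) f \<le> fnorm (associate M (associate M X)) f) \<and>
    (\<forall>f\<in>borel_measurable M. \<forall>fo.
       is_level_function M \<A> f fo \<and> fo \<in> elems (associate M (associate M X)) \<longrightarrow>
       f \<in> elems (down_space M \<A> X) \<and>
       fnorm (down_space M \<A> X) f \<le> fnorm (associate M (associate M X)) fo) \<and>
    sublinear_ae M (core_majorant M \<A>) \<and>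
    banach_function_space M (tilde_space M \<A> X) \<and>
    (fatou_property M X \<longrightarrow> fatou_property M (tilde_space M \<A> X)) \<and>
    same_space (down_space M \<A> X) (associate M (tilde_space M \<A> (associate M X))) \<and>
    same_space (associate M (down_space M \<A> X)) (tilde_space M \<A> (associate M X)) \<and>
    same_space (tilde_space M \<A> (Linfty M)) (Linfty M)"
proof -
  interpret sigma_finite_measure M by fact
  interpret full_core M \<A> by standard fact
  let ?X' = "associate M X" and ?D = "down_space M \<A> X"
  note X = assms(3)
  obtain A :: "nat \<Rightarrow> 'a set" where A: "\<And>n. A n \<in> \<A>" and cover: "(\<Union>n. A n) = space M"
    by (rule core_cover) blast
  note A_sets = core_sets[OF A] and A_fin = core_finite[OF A]
  have ind: "indicator (A n) \<in> elems X" "indicator (A n) \<in> elems ?X'" for n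
    using assms(4) A_sets A_fin by auto
  have [measurable]: "A n \<in> sets M" for n by (rule A_sets)

  interpret B: banach_fs M X by standard (rule X)
  interpret N: function_norm M "bfs_norm X"
    by (rule B.function_norm_bfs_norm[OF A_sets cover ind(2)])

  define \<rho>' where "\<rho>' = pairing_norm M (unit_ball X)"
  have X': "normed_by M ?X' \<rho>'" unfolding \<rho>'_def by (rule normed_by_associate)
  have "fatou_norm M \<rho>'"
    unfolding \<rho>'_def
  proof (rule fatou_norm_pairing_norm[OF _ A_sets cover])
    show "unit_ball X \<subseteq> borel_measurable M"
      by (auto simp: unit_ball_def intro: mag_measurable B.meas)
    fix n
    have "bfs_norm X (mag (indicator (A n))) < top"
      using ind(1)[of n] by (subst B.bfs_norm_mag(1)[symmetric]) auto
    then obtain c where "0 < c" "bfs_norm X (\<lambda>x. c * indicator (A n) x) \<le> 1"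
      using N.small_multiple[of "indicator (A n)"] by auto
    then show "\<exists>c>0. (\<lambda>x. c * indicator (A n) x) \<in> unit_ball X"
      by (intro exI[of _ c] conjI bfs_norm_unit_ball)
  qed
  then interpret N': fatou_norm M \<rho>' .
  have ind': "\<rho>' (indicator (A n)) < top" for n
    using ind(2)[of n] by (simp add: normed_by_mem[OF X'])

  have D: "normed_by M ?D (down \<rho>')" by (rule normed_by_down_space[OF X'])
  have "fatou_norm M (down \<rho>')"
    unfolding down_def
  proof (rule fatou_norm_pairing_norm[OF _ A_sets cover])
    show "{g \<in> decreasing. \<rho>' g \<le> 1} \<subseteq> borel_measurable M" by (auto intro: decreasing_measurable)
    fix n
    obtain c where "0 < c" "\<rho>' (\<lambda>x. c * indicator (A n) x) \<le> 1"
      using N'.small_multiple[OF _ ind'[of n]] by auto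
    then show "\<exists>c>0. (\<lambda>x. c * indicator (A n) x) \<in> {g \<in> decreasing. \<rho>' g \<le> 1}"
      using A by (intro exI[of _ c]) (auto intro: decreasing_scale decreasing_indicator)
  qed
  then interpret ND: fatou_norm M "down \<rho>'" .

  have X'': "normed_by M (associate M ?X') (pairing_norm M {g \<in> borel_measurable M. \<rho>' g \<le> 1})"
    using normed_by_associate[of M ?X'] by (simp add: normed_by_unit_ball[OF X'])

  have tX: "normed_by M (tilde_space M \<A> X) (\<lambda>f. bfs_norm X (majorant f))"
  proof (rule normed_by_tilde_space)
    fix h assume h: "h \<in> core_decreasing M \<A>"
    note h_bfs = B.bfs_norm_mag[OF core_decreasing_measurable[OF h] core_decreasing_nonneg[OF h]]
    show "(h \<in> elems X \<longleftrightarrow> bfs_norm X (mag h) < top) \<and>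
        (h \<in> elems X \<longrightarrow> fnorm X h = enn2real (bfs_norm X (mag h)))"
      using h_bfs by blast
  qed
  have tX': "normed_by M (tilde_space M \<A> ?X') (\<lambda>f. \<rho>' (majorant f))"
    using X' by (intro normed_by_tilde_space) (auto simp: normed_by_def core_decreasing_measurable)
  interpret NT: fatou_norm M "\<lambda>f. \<rho>' (majorant f)"
    by (rule fatou_norm_majorant) (rule N'.fatou_norm_axioms)

  show ?thesis
  proof (intro conjI ballI allI impI)
    show "banach_function_space M ?D" by (rule ND.banach_function_space[OF D])
    show "fatou_property M ?D" by (rule ND.fatou_property[OF D])
  next
    fix f assume f: "f \<in> elems (associate M ?X')"
    have "down \<rho>' (mag f) \<le> pairing_norm M {g \<in> borel_measurable M. \<rho>' g \<le> 1} (mag f)"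
      unfolding down_def by (intro pairing_norm_leI pairing_norm_upper) (auto intro: decreasing_measurable)
    then have "f \<in> elems ?D \<and> fnorm ?D f \<le> fnorm (associate M ?X') f"
      using f by (intro normed_by_compare[OF D X'']) (auto simp: normed_by_mem[OF X''])
    then show "f \<in> elems ?D" "fnorm ?D f \<le> fnorm (associate M ?X') f" by auto
  next
    fix f fo assume f: "f \<in> borel_measurable M"
      and fo: "is_level_function M \<A> f fo \<and> fo \<in> elems (associate M ?X')"
    have "down \<rho>' (mag f) \<le> pairing_norm M {g \<in> borel_measurable M. \<rho>' g \<le> 1} (mag fo)"
      unfolding down_def
      by (rule pairing_norm_leI, rule order_trans[OF level_function_bound pairing_norm_upper])
        (use fo in \<open>auto intro: decreasing_measurable\<close>)
    then have "f \<in> elems ?D \<and> fnorm ?D f \<le> fnorm (associate M ?X') fo"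
      using f fo by (intro normed_by_compare[OF D X'']) auto
    then show "f \<in> elems ?D" "fnorm ?D f \<le> fnorm (associate M ?X') fo" by auto
  next
    show "sublinear_ae M (core_majorant M \<A>)" by (rule sublinear_core_majorant)
  next
    show "banach_function_space M (tilde_space M \<A> X)"
      by (rule function_norm.banach_function_space[OF function_norm_majorant tX])
        (rule N.function_norm_axioms)
  next
    assume "fatou_property M X"
    then show "fatou_property M (tilde_space M \<A> X)"
      by (intro fatou_norm.fatou_property[OF fatou_norm_majorant tX] B.fatou_norm_bfs_norm
          N.function_norm_axioms)
  next
    have "normed_by M (associate M (tilde_space M \<A> ?X'))
        (pairing_norm M {h \<in> borel_measurable M. \<rho>' (majorant h) \<le> 1})"
      using normed_by_associate[of M "tilde_space M \<A> ?X'"] by (simp add: normed_by_unit_ball[OF tX'])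
    then show "same_space ?D (associate M (tilde_space M \<A> ?X'))"
      by (rule normed_by_same_space[OF D]) (rule down_eq_pairing_norm[OF N'.function_norm_axioms])
  next
    have "normed_by M (associate M ?D) (pairing_norm M {g \<in> borel_measurable M. down \<rho>' g \<le> 1})"
      using normed_by_associate[of M ?D] by (simp add: normed_by_unit_ball[OF D])
    then show "same_space (associate M ?D) (tilde_space M \<A> ?X')"
    proof (rule normed_by_same_space[OF _ tX'])
      fix f :: "'a \<Rightarrow> ennreal" assume f: "f \<in> borel_measurable M"
      \<comment> \<open>Core sets are core decreasing, so their indicators have the same norm in both spaces; this
        makes the norm of the tilde space saturated.\<close>
      have "\<rho>' (majorant (indicator (A n))) = \<rho>' (indicator (A n))" for n
        by (intro N'.cong majorant_of_decreasing decreasing_indicator A) auto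
      then have "\<rho>' (majorant (indicator (A n))) < top" for n using ind' by simp
      from NT.lorentz_luxemburg[OF A_sets cover A_fin this f]
      show "pairing_norm M {g \<in> borel_measurable M. down \<rho>' g \<le> 1} f = \<rho>' (majorant f)"
        by (simp add: down_eq_pairing_norm[OF N'.function_norm_axioms] cong: conj_cong)
    qed
  next
    show "same_space (tilde_space M \<A> (Linfty M)) (Linfty M)" by (rule tilde_space_Linfty)
  qed
qed

end
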